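(* Let $T$ be the $30^\circ$-$60^\circ$-$90^\circ$ triangle with side lengths $a=\frac{3+4\sqrt3}{18}$, $b=\frac{4+\sqrt3}{6}$, $c=2a$ (short leg, long leg, hypotenuse), and let $T/1.0048$ denote its homothetic copy with ratio $1/1.0048$. Then $T/1.0048$ covers every unit arc, i.e. every unit arc in $\mathbb{R}^2$ is contained in a congruent copy of $T/1.0048$. Its area is $$\Bigl(\frac{1}{1.0048}\Bigr)^{2}\cdot\frac{24+19\sqrt3}{216}=0.260956\ldots<\frac{\pi}{12},$$ where $\pi/12\approx 0.261799$ is the area of the $30^\circ$ circular sector of radius $1$.
   Context: An arc is a rectifiable simple curve in $\mathbb{R}^2$ (the image of a continuous injective map from a compact interval, of finite length); a unit arc is an arc of length $1$. Triangles are closed triangular regions (including the interior). A congruent copy is an image under an isometry of the plane (reflections allowed). *)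

theory Defs
  imports "HOL-Analysis.Analysis"
begin

text \<open>Length of a parametrised curve on \<open>[0,1]\<close>: supremum of the lengths of all inscribed polygonal
  lines, possibly infinite. Repeated parameters in \<open>ts\<close> only contribute zero summands.\<close>

definition curve_length :: "(real \<Rightarrow> 'a::metric_space) \<Rightarrow> ennreal" where
  "curve_length g =
     (SUP ts\<in>{ts. sorted ts \<and> set ts \<subseteq> {0..1}}.
        ennreal (\<Sum>i<length ts - 1. dist (g (ts ! i)) (g (ts ! Suc i))))"

definition unit_arc :: "(real^2) set \<Rightarrow> bool" where
  "unit_arc \<Gamma> \<longleftrightarrow> (\<exists>g. arc g \<and> path_image g = \<Gamma> \<and> curve_length g = 1)"

definition plane_isometry :: "(real^2 \<Rightarrow> real^2) \<Rightarrow> bool" where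
  "plane_isometry f \<longleftrightarrow> (\<forall>x y. dist (f x) (f y) = dist x y)"

definition congruent_copy :: "(real^2) set \<Rightarrow> (real^2) set \<Rightarrow> bool" where
  "congruent_copy X Y \<longleftrightarrow> (\<exists>f. plane_isometry f \<and> Y = f ` X)"

definition covers_unit_arcs :: "(real^2) set \<Rightarrow> bool" where
  "covers_unit_arcs X \<longleftrightarrow> (\<forall>\<Gamma>. unit_arc \<Gamma> \<longrightarrow> (\<exists>Y. congruent_copy X Y \<and> \<Gamma> \<subseteq> Y))"

text \<open>Angle at the vertex \<open>Q\<close>, for \<open>P \<noteq> Q\<close> and \<open>R \<noteq> Q\<close>.\<close>

definition angle_at :: "real^2 \<Rightarrow> real^2 \<Rightarrow> real^2 \<Rightarrow> real" where
  "angle_at P Q R = arccos (((P - Q) \<bullet> (R - Q)) / (norm (P - Q) * norm (R - Q)))"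

definition circular_sector :: "real^2 \<Rightarrow> real \<Rightarrow> real \<Rightarrow> real \<Rightarrow> (real^2) set" where
  "circular_sector p r \<phi> \<alpha> =
     {p + \<rho> *\<^sub>R vector [cos \<theta>, sin \<theta>] | \<rho> \<theta>. 0 \<le> \<rho> \<and> \<rho> \<le> r \<and> \<phi> \<le> \<theta> \<and> \<theta> \<le> \<phi> + \<alpha>}"

text \<open>The prescribed angles and side lengths are consistent.\<close>

lemma triangle_30_60_90_exists:
  fixes a b c :: real
  assumes a: "a = (3 + 4 * sqrt 3) / 18" and b: "b = (4 + sqrt 3) / 6" and c: "c = 2 * a"
  shows "\<exists>A B C :: real^2.
    angle_at B A C = pi / 6 \<and> angle_at A B C = pi / 3 \<and> angle_at A C B = pi / 2 \<and>
    dist B C = a \<and> dist A C = b \<and> dist A B = c"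
proof -
  define A B C :: "real^2" where "A = vector [0, b]" and "B = vector [a, 0]" and "C = 0"
  have pos: "a > 0" "b > 0" "c > 0"
    unfolding a b c by (simp_all add: add_pos_pos)
  have ba: "b = sqrt 3 * a"
    unfolding a b by (simp add: field_simps)
  have sq: "a\<^sup>2 + b\<^sup>2 = c\<^sup>2"
    unfolding ba c by (simp add: power_mult_distrib)
  have comps [simp]: "A $ 1 = 0" "A $ 2 = b" "B $ 1 = a" "B $ 2 = 0" "C = 0"
    by (simp_all add: A_def B_def C_def)
  have sc: "sqrt (a\<^sup>2 + b\<^sup>2) = c" "sqrt (b\<^sup>2 + a\<^sup>2) = c"
    using sq pos by (simp_all add: add.commute)
  have n: "norm (B - C) = a" "norm (A - C) = b" "norm (A - B) = c"
    using pos sc by (simp_all add: norm_vec_def L2_set_def sum_2)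
  have n': "norm (C - B) = a" "norm (C - A) = b" "norm (B - A) = c"
    using n by (metis norm_minus_commute)+
  have i: "(B - A) \<bullet> (C - A) = b\<^sup>2" "(A - B) \<bullet> (C - B) = a\<^sup>2" "(A - C) \<bullet> (B - C) = 0"
    by (simp_all add: inner_vec_def sum_2 power2_eq_square)
  have q: "b\<^sup>2 / (c * b) = sqrt 3 / 2" "a\<^sup>2 / (c * a) = 1 / 2"
    using pos unfolding ba c by (simp_all add: power2_eq_square)
  have "arccos (sqrt 3 / 2) = pi / 6" "arccos (1 / 2) = pi / 3"
    using arccos_cos[of "pi/6"] arccos_cos[of "pi/3"] by (simp_all add: cos_30 cos_60)
  then have "angle_at B A C = pi / 6" "angle_at A B C = pi / 3" "angle_at A C B = pi / 2"
    unfolding angle_at_def n n' i q by simp_all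
  then show ?thesis
    using n unfolding dist_norm by blast
qed

end

theory Submission
  imports Defs
begin

text \<open>
  Let \<open>\<beta>\<close> be the long leg of the scaled triangle and \<open>h\<close> the support function of an arc. Let \<open>u\<close> be a unit
  vector, \<open>w\<close> one of the two unit vectors orthogonal to \<open>u\<close>, and \<open>z = - (u + sqrt 3 w) / 2\<close>. The triangle
  with outward normals \<open>u\<close> (short leg), \<open>w\<close> (long leg) and \<open>z\<close> (hypotenuse) that is circumscribed about the
  arc has long leg \<open>h(u) + sqrt 3 h(w) + 2 h(z)\<close>. Call this number the width of the placement \<open>(u, w)\<close>. The arc is
  covered as soon as one width is at most \<open>\<beta>\<close>, so suppose that all widths exceed \<open>\<beta>\<close>.

  The contradiction comes from summation by parts. Each support value is attained at some time of
  the arc, so a combination of finitely many widths with nonnegative weights is a sum of terms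
  \<open>v \<bullet> \<gamma>(t)\<close> whose vectors \<open>v\<close> add up to zero. With the touching times sorted, this sum is the sum of
  \<open>- P \<bullet> \<Delta>\<close>, where \<open>\<Delta>\<close> runs through the steps of the polygon inscribed at these times and \<open>P\<close> is the sum of
  the vectors met so far (\<open>abel_polygon\<close>). If no partial sum is longer than \<open>\<beta>\<close> times the total
  weight, an arc of length 1 cannot have all these widths above \<open>\<beta>\<close>.

  Which partial sums occur depends only on the order of the touching times. Therefore the proof
  branches on comparisons of two touching times until one choice of weights bounds the partial sums
  over all sets of directions that are closed under the comparisons made so far
  (\<open>no_certificate\<close>). The resulting binary tree has 87 leaves. Everything is exact: the normals are
  integer vectors turned by multiples of 30 degrees, their coordinates lie in \<open>\<int>[sqrt 3]\<close> up to a factor 2,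
  and the conditions at the leaves are finitely many inequalities between integers.

  Rotations and reflections are removed in advance. The chord from the start to the end of the arc is
  made horizontal, which permits adding multiples of the chord condition to a combination, and the
  highest point is visited before the lowest one, since otherwise the plane can be reflected in the
  chord (\<open>unit_arc_covered\<close>).

  The weights at a leaf are a rounded solution of the convex program dual to minimising the length of
  a polygon that meets its touching points in one of the remaining orders. The estimate is nearly
  attained: numerically, there is a U-shaped trapezoidal arc with three segments of length about 1/3
  all of whose widths exceed \<open>0.9506\<close>, while \<open>\<beta> = 0.95077\<dots>\<close>.
\<close>

section \<open>Summation by parts along an arc\<close>

text \<open>
  Every \<open>g (t i)\<close> is \<open>g 1\<close> minus the later steps of the polygon through all these points. After an exchange
  of summations, the step that begins at time \<open>s\<close> is paired with the sum of the vectors whose times are at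
  most \<open>s\<close>. Working with times instead of sorted indices makes coinciding times harmless.
\<close>

lemma abel_polygon:
  fixes g :: "real \<Rightarrow> 'a::real_inner" and v :: "'i \<Rightarrow> 'a"
  assumes fin: "finite I"
    and range: "\<And>i. i \<in> I \<Longrightarrow> 0 \<le> t i \<and> t i \<le> 1"
    and short: "\<And>ts. sorted ts \<Longrightarrow> set ts \<subseteq> {0..1} \<Longrightarrow>
      (\<Sum>i<length ts - 1. dist (g (ts ! i)) (g (ts ! Suc i))) \<le> 1"
    and bound: "\<And>s. 0 \<le> s \<Longrightarrow> s \<le> 1 \<Longrightarrow> norm (u + (\<Sum>i\<in>{i\<in>I. t i \<le> s}. v i)) \<le> R"
  shows "(\<Sum>i\<in>I. v i \<bullet> g (t i)) + u \<bullet> g 0 \<le> (u + (\<Sum>i\<in>I. v i)) \<bullet> g 1 + R"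
proof -
  define ts where "ts = sorted_list_of_set (insert 0 (insert 1 (t ` I)))"
  have set_ts: "set ts = insert 0 (insert 1 (t ` I))"
    unfolding ts_def by (rule set_sorted_list_of_set) (simp add: fin)
  have strict: "sorted_wrt (<) ts" unfolding ts_def by (rule strict_sorted_list_of_set)
  have in01: "set ts \<subseteq> {0..1}" using range by (auto simp: set_ts)
  define n where "n = length ts - 1"
  have len: "length ts = Suc n" using set_ts by (cases ts) (auto simp: n_def)
  have nth_le: "ts ! i \<le> ts ! j \<longleftrightarrow> i \<le> j" if "i \<le> n" "j \<le> n" for i j
    using sorted_wrt_nth_less[OF strict, of i j] sorted_wrt_nth_less[OF strict, of j i] that len
    by (cases i j rule: linorder_cases) auto
  have last: "ts ! n = 1"
  proof -
    obtain k where k: "k < Suc n" "ts ! k = 1"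
    proof -
      have "1 \<in> set ts" by (simp add: set_ts)
      then show ?thesis using that len by (auto simp: in_set_conv_nth)
    qed
    have "ts ! n \<in> set ts" using len by simp
    then have "ts ! n \<le> 1" using in01 by auto
    with nth_le[of k n] k show ?thesis by auto
  qed
  define \<Delta> where "\<Delta> i = g (ts ! Suc i) - g (ts ! i)" for i
  have tele: "g s = g 1 - (\<Sum>i<n. if s \<le> ts ! i then \<Delta> i else 0)" if s: "s \<in> set ts" for s
  proof -
    obtain k where k: "k \<le> n" "ts ! k = s"
      using s len by (auto simp: in_set_conv_nth less_Suc_eq_le)
    have "(\<Sum>i<n. if s \<le> ts ! i then \<Delta> i else 0) = (\<Sum>i\<in>{i\<in>{..<n}. s \<le> ts ! i}. \<Delta> i)"
      by (rule sum.inter_filter[symmetric]) simp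
    also have "{i\<in>{..<n}. s \<le> ts ! i} = {k..<n}"
      using nth_le[of k] k by auto
    also have "(\<Sum>i\<in>{k..<n}. \<Delta> i) = g 1 - g s"
      unfolding \<Delta>_def using sum_Suc_diff'[of k n "\<lambda>i. g (ts ! i)"] k last by simp
    finally show ?thesis by simp
  qed
  define P where "P i = u + (\<Sum>j\<in>{j\<in>I. t j \<le> ts ! i}. v j)" for i
  have "(\<Sum>i\<in>I. v i \<bullet> g (t i)) + u \<bullet> g 0
      = (\<Sum>i\<in>I. v i \<bullet> g 1 - (\<Sum>j<n. if t i \<le> ts ! j then v i \<bullet> \<Delta> j else 0))
        + (u \<bullet> g 1 - (\<Sum>j<n. u \<bullet> \<Delta> j))"
  proof (intro arg_cong2[where f="(+)"] sum.cong refl)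
    fix i assume "i \<in> I"
    then show "v i \<bullet> g (t i) = v i \<bullet> g 1 - (\<Sum>j<n. if t i \<le> ts ! j then v i \<bullet> \<Delta> j else 0)"
      using tele[of "t i"] by (simp add: set_ts inner_diff_right inner_sum_right if_distrib cong: if_cong)
  next
    have "0 \<le> ts ! j" if "j < n" for j using in01 len that by (auto simp: subset_iff)
    then have "(\<Sum>i<n. if 0 \<le> ts ! i then \<Delta> i else 0) = (\<Sum>i<n. \<Delta> i)" by (intro sum.cong) auto
    with tele[of 0] show "u \<bullet> g 0 = u \<bullet> g 1 - (\<Sum>j<n. u \<bullet> \<Delta> j)"
      by (simp add: set_ts inner_diff_right inner_sum_right)
  qed
  also have "\<dots> = (u + (\<Sum>i\<in>I. v i)) \<bullet> g 1
      - (\<Sum>j<n. u \<bullet> \<Delta> j + (\<Sum>i\<in>I. if t i \<le> ts ! j then v i \<bullet> \<Delta> j else 0))"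
    using sum.swap[of "\<lambda>i j. if t i \<le> ts ! j then v i \<bullet> \<Delta> j else 0" "{..<n}" I]
    unfolding sum_subtractf sum.distrib inner_add_left inner_sum_left by linarith
  also have "(\<Sum>j<n. u \<bullet> \<Delta> j + (\<Sum>i\<in>I. if t i \<le> ts ! j then v i \<bullet> \<Delta> j else 0)) = (\<Sum>j<n. P j \<bullet> \<Delta> j)"
    by (auto simp: P_def inner_add_left inner_sum_left sum.inter_filter fin intro!: sum.cong)
  also have "- (\<Sum>j<n. P j \<bullet> \<Delta> j) \<le> R"
  proof -
    have R0: "0 \<le> R" by (rule order_trans[OF norm_ge_zero bound[of 0]]) simp_all
    have "- (P j \<bullet> \<Delta> j) \<le> R * dist (g (ts ! j)) (g (ts ! Suc j))" if "j < n" for j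
    proof -
      have "ts ! j \<in> {0..1}" using in01 len that by (auto simp: subset_iff)
      then have "norm (P j) \<le> R" unfolding P_def using bound by simp
      moreover have "\<bar>P j \<bullet> \<Delta> j\<bar> \<le> norm (P j) * norm (\<Delta> j)" by (rule Cauchy_Schwarz_ineq2)
      moreover have "norm (\<Delta> j) = dist (g (ts ! j)) (g (ts ! Suc j))"
        by (simp add: \<Delta>_def dist_norm norm_minus_commute)
      ultimately show ?thesis
        using mult_right_mono[of "norm (P j)" R "norm (\<Delta> j)"] by simp
    qed
    then have "(\<Sum>j<n. - (P j \<bullet> \<Delta> j)) \<le> R * (\<Sum>j<n. dist (g (ts ! j)) (g (ts ! Suc j)))"
      unfolding sum_distrib_left by (intro sum_mono) simp
    also have "\<dots> \<le> R * 1"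
      using short[of ts] strict in01 R0 by (intro mult_left_mono) (auto simp: n_def strict_sorted_iff)
    finally show ?thesis by (simp add: sum_negf)
  qed
  then have "(u + (\<Sum>i\<in>I. v i)) \<bullet> g 1 - (\<Sum>j<n. P j \<bullet> \<Delta> j) \<le> (u + (\<Sum>i\<in>I. v i)) \<bullet> g 1 + R"
    by simp
  finally show ?thesis .
qed

section \<open>Directions with coordinates in \<open>\<int>[sqrt 3]\<close>\<close>

text \<open>
  The direction \<open>(k, m)\<close> is the vector \<open>2 (16, k)\<close> turned by \<open>m\<close> times 30 degrees; the factor 2 clears the
  denominators of the cosines. Since the three normals of a placement differ by multiples of 30
  degrees, they stay in one such family, and different placements share touching points.
\<close>

type_synonym dir = "int \<times> int"

text \<open>
  \<open>(a, b, c, d)\<close> stands for the point \<open>(a + b sqrt 3, c + d sqrt 3)\<close>.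
\<close>

type_synonym zvec = "int \<times> int \<times> int \<times> int"

definition wrap :: "int \<Rightarrow> int" where
  "wrap m = (if m < 0 then m + 12 else if 12 \<le> m then m - 12 else m)"

text \<open>
  Twice the cosine of \<open>m\<close> times 30 degrees, as an element of \<open>\<int>[sqrt 3]\<close>.
\<close>

definition cos2 :: "int \<Rightarrow> int \<times> int" where
  "cos2 m = (if m = 0 then (2,0) else if m = 1 then (0,1) else if m = 2 then (1,0) else if m = 3 then (0,0)
   else if m = 4 then (-1,0) else if m = 5 then (0,-1) else if m = 6 then (-2,0) else if m = 7 then (0,-1)
   else if m = 8 then (-1,0) else if m = 9 then (0,0) else if m = 10 then (1,0) else (0,1))"

fun coordinates :: "dir \<Rightarrow> zvec" where
  "coordinates (k, m) = (case cos2 m of (c, c') \<Rightarrow> case cos2 (wrap (m - 3)) of (s, s') \<Rightarrow>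
     (16 * c - k * s, 16 * c' - k * s', 16 * s + k * c, 16 * s' + k * c'))"

fun zscale :: "int \<times> int \<Rightarrow> zvec \<Rightarrow> zvec" where
  "zscale (p, q) (a, b, c, d) = (p * a + 3 * q * b, p * b + q * a, p * c + 3 * q * d, p * d + q * c)"

fun zadd :: "zvec \<Rightarrow> zvec \<Rightarrow> zvec" where
  "zadd (a, b, c, d) (a', b', c', d') = (a + a', b + b', c + c', d + d')"

definition long_side :: "int \<Rightarrow> bool \<Rightarrow> int" where "long_side m r = wrap (if r then m + 3 else m - 3)"

definition hyp_side :: "int \<Rightarrow> bool \<Rightarrow> int" where "hyp_side m r = wrap (if r then m - 4 else m + 4)"

definition ring_value :: "int \<times> int \<Rightarrow> real" where
  "ring_value x = of_int (fst x) + of_int (snd x) * sqrt 3"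

fun point :: "zvec \<Rightarrow> real \<times> real" where
  "point (a, b, c, d) = (of_int a + of_int b * sqrt 3, of_int c + of_int d * sqrt 3)"

lemma point_zadd: "point (zadd u v) = point u + point v"
  by (cases u; cases v) (simp add: algebra_simps)

lemma point_zscale: "point (zscale p v) = ring_value p *\<^sub>R point v"
proof -
  obtain x y where p: "p = (x, y)" by (cases p)
  obtain a b c d where v: "v = (a, b, c, d)" by (cases v)
  have q: "sqrt 3 * (sqrt 3 * z) = 3 * z" for z :: real by simp
  show ?thesis unfolding p v by (simp add: ring_value_def algebra_simps q)
qed

lemma sqrt3_bounds: "1.7320508 \<le> sqrt (3::real)" "sqrt 3 \<le> (1.7320509::real)"
  by (rule real_le_rsqrt, simp add: power2_eq_square) (rule real_le_lsqrt, simp_all add: power2_eq_square)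

lemma less_12_cases:
  assumes "0 \<le> m" "m < (12::int)"
  shows "m = 0 \<or> m = 1 \<or> m = 2 \<or> m = 3 \<or> m = 4 \<or> m = 5 \<or>
    m = 6 \<or> m = 7 \<or> m = 8 \<or> m = 9 \<or> m = 10 \<or> m = 11"
  using assms by presburger

lemma sides_distinct:
  assumes "0 \<le> m" "m < 12"
  shows "m \<noteq> long_side m r" "m \<noteq> hyp_side m r" "long_side m r \<noteq> hyp_side m r"
  using assms by (auto simp: long_side_def hyp_side_def wrap_def)

definition normal :: "dir \<Rightarrow> real \<times> real" where "normal e = point (coordinates e)"

fun turn :: "bool \<Rightarrow> real \<times> real \<Rightarrow> real \<times> real" where
  "turn r (x, y) = (if r then (- y, x) else (y, - x))"

text \<open>
  The outward normals of a triangle, weighted by the side lengths \<open>1 : sqrt 3 : 2\<close>, add up to zero.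
\<close>

lemma normal_sides:
  assumes "0 \<le> m" "m < 12"
  shows "normal (k, long_side m r) = turn r (normal (k, m))"
    and "2 *\<^sub>R normal (k, hyp_side m r) = - normal (k, m) - sqrt 3 *\<^sub>R normal (k, long_side m r)"
    and "norm (normal (k, m)) = 2 * sqrt (256 + (of_int k)\<^sup>2)"
proof -
  have q: "sqrt 3 * sqrt 3 = (3::real)" "sqrt 3 * (sqrt 3 * x) = 3 * x" for x :: real by simp_all
  note m = less_12_cases[OF assms]
  show "normal (k, long_side m r) = turn r (normal (k, m))"
    using m by (elim disjE; cases r; simp add: normal_def long_side_def wrap_def cos2_def)
  show "2 *\<^sub>R normal (k, hyp_side m r) = - normal (k, m) - sqrt 3 *\<^sub>R normal (k, long_side m r)"
    using m by (elim disjE; cases r; simp add: normal_def hyp_side_def long_side_def wrap_def cos2_def algebra_simps q)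
  have "normal (k, m) \<bullet> normal (k, m) = 4 * (256 + (of_int k)\<^sup>2)"
    using m by (elim disjE; simp add: normal_def wrap_def cos2_def power2_eq_square algebra_simps q)
  also have "\<dots> = (2 * sqrt (256 + (of_int k)\<^sup>2))\<^sup>2"
    by (simp add: power_mult_distrib)
  finally show "norm (normal (k, m)) = 2 * sqrt (256 + (of_int k)\<^sup>2)"
    unfolding power2_norm_eq_inner[symmetric] by (rule power2_eq_imp_eq) simp_all
qed

section \<open>Widths of placements\<close>

text \<open>
  The long leg of the scaled triangle.
\<close>

definition beta :: real where "beta = (4 + sqrt 3) / 6 / 1.0048"

text \<open>
  A placement \<open>(k, m, r)\<close> has the normal \<open>(k, m)\<close> on its short leg; \<open>r\<close> selects one of the two mirror images. If \<open>f\<close>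
  is the support function on the vectors \<open>normal e\<close>, the value below is the long leg of the circumscribed triangle, times the
  norm of \<open>normal (k, m)\<close>.
\<close>

fun width :: "(dir \<Rightarrow> real) \<Rightarrow> int \<times> int \<times> bool \<Rightarrow> real" where
  "width f (k, m, r) = f (k, m) + sqrt 3 * f (k, long_side m r) + 2 * f (k, hyp_side m r)"

text \<open>
  Since the three weighted normals cancel, a translation of the arc does not change its widths.
\<close>

lemma width_constant:
  assumes "0 \<le> m" "m < 12"
  shows "width (\<lambda>e. normal e \<bullet> x) (k, m, r) = 0"
proof -
  have "width (\<lambda>e. normal e \<bullet> x) (k, m, r)
      = (normal (k, m) + sqrt 3 *\<^sub>R normal (k, long_side m r) + 2 *\<^sub>R normal (k, hyp_side m r)) \<bullet> x"
    by (simp add: inner_add_left)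
  also have "\<dots> = 0" by (subst normal_sides(2)[OF assms]) simp
  finally show ?thesis .
qed

section \<open>Certificates\<close>

text \<open>
  The first branch of \<open>Split e f\<close> treats the arcs that touch in direction \<open>e\<close> no later than in direction \<open>f\<close>, the second
  one the others. An entry \<open>(k, m, r, w)\<close> of a leaf is a placement with its weight \<open>w\<close>; the two integers
  are the multipliers of the chord conditions.
\<close>

datatype certificate =
  Split dir dir certificate certificate
| Leaf "(int \<times> int \<times> bool \<times> int) list" int int

text \<open>
  Several placements may use the same direction; the coefficient of the direction collects their weights,
  which are multiplied by 1, \<open>sqrt 3\<close> or 2 according to the side, in \<open>\<int>[sqrt 3]\<close>.
\<close>

fun coefficient :: "(int \<times> int \<times> bool \<times> int) list \<Rightarrow> dir \<Rightarrow> int \<times> int" where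
  "coefficient [] e = (0, 0)"
| "coefficient ((k, m, r, w) # ps) (k', m') = (case coefficient ps (k', m') of (p, q) \<Rightarrow>
     if k = k' then
       (if m' = m then (p + w, q) else if m' = long_side m r then (p, q + w)
        else if m' = hyp_side m r then (p + 2 * w, q) else (p, q))
     else (p, q))"

fun used_directions :: "(int \<times> int \<times> bool \<times> int) list \<Rightarrow> dir list" where
  "used_directions [] = []"
| "used_directions ((k, m, r, w) # ps) =
     List.insert (k, m) (List.insert (k, long_side m r) (List.insert (k, hyp_side m r) (used_directions ps)))"

text \<open>
  The integer part of \<open>10\<^sup>5 \<beta>\<close> times the norm of the direction, for the values of \<open>k\<close> that occur. The default
  0 is a valid lower bound too.
\<close>

fun width_bound :: "int \<Rightarrow> int" where
  "width_bound k = (if k = 0 then 3042489 else if \<bar>k\<bar> = 2 then 3066167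
     else if \<bar>k\<bar> = 3 then 3095509 else if \<bar>k\<bar> = 4 then 3136126 else 0)"

fun total_bound :: "(int \<times> int \<times> bool \<times> int) list \<Rightarrow> int" where
  "total_bound [] = 0"
| "total_bound ((k, m, r, w) # ps) = w * width_bound k + total_bound ps"

text \<open>
  This implies \<open>10\<^sup>1\<^sup>0 \<bar>v\<bar>\<^sup>2 \<le> B\<close>: in \<open>\<bar>v\<bar>\<^sup>2 = E + G sqrt 3\<close> the root is replaced by its upper or lower 7-digit
  approximation according to the sign of \<open>G\<close>.
\<close>

fun norm_at_most :: "int \<Rightarrow> zvec \<Rightarrow> bool" where
  "norm_at_most B (a, b, c, d) = (let G = 2 * (a * b + c * d) in
     (10000000 * (a * a + 3 * (b * b) + c * c + 3 * (d * d)) + G * (if 0 \<le> G then 17320509 else 17320508)) * 1000 \<le> B)"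

text \<open>
  The directions touched up to some time form a set that contains, with each direction, those known to be touched
  before it. All sets with this property are run through by deciding one direction after the other;
  \<open>ins\<close> and \<open>outs\<close> are the decisions made and \<open>v\<close> is the partial sum. A choice is skipped if it contradicts
  an earlier one.
\<close>

fun sweep ::
  "int \<Rightarrow> (dir \<times> dir list \<times> dir list \<times> zvec) list \<Rightarrow> dir list \<Rightarrow> dir list \<Rightarrow> zvec \<Rightarrow> bool" where
  "sweep B [] ins outs v \<longleftrightarrow> norm_at_most B v"
| "sweep B ((e, before, after, c) # es) ins outs v \<longleftrightarrow>
     ((\<exists>x\<in>set before. x \<in> set outs) \<or> sweep B es (e # ins) outs (zadd v c)) \<and>
     ((\<exists>y\<in>set after. y \<in> set ins) \<or> sweep B es ins (e # outs) v)"

definition events ::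
  "(dir \<times> dir) list \<Rightarrow> (int \<times> int \<times> bool \<times> int) list \<Rightarrow> (dir \<times> dir list \<times> dir list \<times> zvec) list" where
  "events R ps = map (\<lambda>e. (e, filter (\<lambda>x. (x, e) \<in> set R) (used_directions ps),
     filter (\<lambda>y. (e, y) \<in> set R) (used_directions ps),
     zscale (coefficient ps e) (coordinates e))) (used_directions ps)"

text \<open>
  The chord conditions contribute the vector \<open>(- \<mu>, l)\<close> at the start point, hence to every partial sum.
\<close>

fun refutes :: "(dir \<times> dir) list \<Rightarrow> certificate \<Rightarrow> bool" where
  "refutes R (Split e f A B) \<longleftrightarrow> refutes ((e, f) # R) A \<and> refutes ((f, e) # R) B"
| "refutes R (Leaf ps l \<mu>) \<longleftrightarrow>
     0 \<le> \<mu> \<and> ps \<noteq> [] \<and> (\<forall>(k, m, r, w)\<in>set ps. 0 < w \<and> 0 \<le> m \<and> m < 12) \<and>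
     sweep ((total_bound ps)\<^sup>2) (events R ps) [] [] (- \<mu>, 0, l, 0)"

section \<open>Soundness of certificates\<close>

lemma norm_at_most_sound:
  assumes "norm_at_most (B\<^sup>2) v" "0 \<le> B"
  shows "norm (point v) \<le> of_int B / 10^5"
proof -
  obtain a b c d where v: "v = (a, b, c, d)" by (cases v)
  define E G where "E = a * a + 3 * (b * b) + c * c + 3 * (d * d)" and "G = 2 * (a * b + c * d)"
  define s :: int where "s = (if 0 \<le> G then 17320509 else 17320508)"
  have *: "(10000000 * E + G * s) * 1000 \<le> B\<^sup>2"
    using assms(1) by (simp add: v E_def G_def s_def Let_def)
  have "real_of_int G * sqrt 3 \<le> real_of_int G * (of_int s / 10^7)"
  proof (cases "0 \<le> G")
    case True
    have "sqrt 3 \<le> of_int s / 10^7" using True sqrt3_bounds(2) by (simp add: s_def)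
    then show ?thesis using True by (intro mult_left_mono) simp_all
  next
    case False
    have "of_int s / 10^7 \<le> sqrt 3" using False sqrt3_bounds(1) by (simp add: s_def)
    then show ?thesis using False by (intro mult_left_mono_neg) simp_all
  qed
  moreover have "(norm (point v))\<^sup>2 = of_int E + of_int G * sqrt 3"
  proof -
    have "sqrt 3 * sqrt 3 = (3::real)" by simp
    then show ?thesis
      unfolding v power2_norm_eq_inner by (simp add: E_def G_def algebra_simps)
  qed
  ultimately have "(norm (point v))\<^sup>2 * 10^10 \<le> real_of_int ((10000000 * E + G * s) * 1000)"
    by simp
  also have "\<dots> \<le> (of_int B)\<^sup>2"
    using * by (simp only: of_int_le_iff of_int_power[symmetric])
  finally have "(norm (point v) * 10^5)\<^sup>2 \<le> (of_int B)\<^sup>2" by (simp only: power_mult_distrib power_mult[symmetric]) simp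
  then have "norm (point v) * 10^5 \<le> of_int B"
    by (rule power2_le_imp_le) (simp add: assms(2))
  then show ?thesis by (simp add: field_simps)
qed

text \<open>
  A set \<open>D\<close> that respects all order constraints is never skipped.
\<close>

lemma sweep_sound:
  assumes "sweep (B\<^sup>2) es ins outs v" "0 \<le> B"
    and "\<And>e before after c x. (e, before, after, c) \<in> set es \<Longrightarrow> x \<in> set before \<Longrightarrow> e \<in> D \<Longrightarrow> x \<in> D"
    and "\<And>e before after c y. (e, before, after, c) \<in> set es \<Longrightarrow> y \<in> set after \<Longrightarrow> y \<in> D \<Longrightarrow> e \<in> D"
    and "set ins \<subseteq> D" "set outs \<inter> D = {}"
  shows "norm (point v + (\<Sum>(e, _, _, c)\<leftarrow>es. if e \<in> D then point c else 0)) \<le> of_int B / 10^5"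
  using assms(1,3-)
proof (induction es arbitrary: ins outs v)
  case Nil
  then show ?case using norm_at_most_sound \<open>0 \<le> B\<close> by simp
next
  case (Cons p es)
  obtain e before after c where p: "p = (e, before, after, c)" by (cases p)
  have closed: "\<And>e before after c x. (e, before, after, c) \<in> set es \<Longrightarrow> x \<in> set before \<Longrightarrow> e \<in> D \<Longrightarrow> x \<in> D"
    "\<And>e before after c y. (e, before, after, c) \<in> set es \<Longrightarrow> y \<in> set after \<Longrightarrow> y \<in> D \<Longrightarrow> e \<in> D"
    using Cons.prems(2,3) by (meson list.set_intros(2))+
  show ?case
  proof (cases "e \<in> D")
    case True
    have "\<not> (\<exists>x\<in>set before. x \<in> set outs)"
      using Cons.prems(2)[of e before after c] Cons.prems(5) True by (auto simp: p)
    then have "sweep (B\<^sup>2) es (e # ins) outs (zadd v c)"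
      using Cons.prems(1) by (simp add: p)
    then have "norm (point (zadd v c) + (\<Sum>(e, _, _, c)\<leftarrow>es. if e \<in> D then point c else 0)) \<le> of_int B / 10^5"
      by (rule Cons.IH[OF _ closed]) (use Cons.prems(4,5) True in auto)
    then show ?thesis using True by (simp add: p point_zadd add.assoc)
  next
    case False
    have "\<not> (\<exists>y\<in>set after. y \<in> set ins)"
      using Cons.prems(3)[of e before after c] Cons.prems(4) False by (auto simp: p)
    then have "sweep (B\<^sup>2) es ins (e # outs) v"
      using Cons.prems(1) by (simp add: p)
    then have "norm (point v + (\<Sum>(e, _, _, c)\<leftarrow>es. if e \<in> D then point c else 0)) \<le> of_int B / 10^5"
      by (rule Cons.IH[OF _ closed]) (use Cons.prems(4,5) False in auto)
    then show ?thesis using False by (simp add: p)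
  qed
qed

lemma width_bound_le: "of_int (width_bound k) / 10^5 \<le> beta * norm (normal (k, 0))"
proof -
  \<comment> \<open>The constant is a rational lower bound for \<open>\<beta>\<close>.\<close>
  have q: "of_int z / 10^5 \<le> beta * (2 * sqrt x)"
    if "(of_int z / (10^5 * 2 * 0.95077806))\<^sup>2 \<le> x" for z :: int and x :: real
  proof -
    have "0.95077806 \<le> beta" using sqrt3_bounds(1) by (simp add: beta_def)
    moreover have "of_int z / (10^5 * 2 * 0.95077806) \<le> sqrt x" using that by (rule real_le_rsqrt)
    moreover have "0 \<le> sqrt x" using that by (intro real_sqrt_ge_zero) (rule order_trans[OF zero_le_power2])
    ultimately have "0.95077806 * (2 * sqrt x) \<le> beta * (2 * sqrt x)" by (intro mult_right_mono) simp_all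
    moreover have "of_int z / 10^5 \<le> 0.95077806 * (2 * sqrt x)"
      using \<open>of_int z / _ \<le> sqrt x\<close> by simp
    ultimately show ?thesis by simp
  qed
  have "(of_int (width_bound k) / (10^5 * 2 * 0.95077806))\<^sup>2 \<le> 256 + (of_int \<bar>k\<bar> :: real)\<^sup>2"
    unfolding width_bound.simps
    by (cases "k = 0"; cases "\<bar>k\<bar> = 2"; cases "\<bar>k\<bar> = 3"; cases "\<bar>k\<bar> = 4")
      (simp_all add: power2_eq_square del: of_int_abs)
  moreover have n: "norm (normal (k, 0)) = 2 * sqrt (256 + (of_int \<bar>k\<bar>)\<^sup>2)"
    using normal_sides(3)[of 0 k] by simp
  ultimately show ?thesis
    unfolding n by (intro q)
qed

lemma weighted_widths:
  assumes "finite E" "set (used_directions ps) \<subseteq> E"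
    and "\<And>k m r w. (k, m, r, w) \<in> set ps \<Longrightarrow> 0 \<le> m \<and> m < 12"
  shows "(\<Sum>e\<in>E. ring_value (coefficient ps e) * f e) = (\<Sum>(k, m, r, w)\<leftarrow>ps. of_int w * width f (k, m, r))"
  using assms
proof (induction ps)
  case Nil
  then show ?case by (simp add: ring_value_def)
next
  case (Cons p ps)
  obtain k m r w where p: "p = (k, m, r, w)" by (cases p)
  have m: "0 \<le> m" "m < 12" using Cons.prems(3) p by auto
  have sub: "(k, m) \<in> E" "(k, long_side m r) \<in> E" "(k, hyp_side m r) \<in> E" "set (used_directions ps) \<subseteq> E"
    using Cons.prems(2) by (auto simp: p)
  have q: "ring_value (coefficient (p # ps) e) = ring_value (coefficient ps e) + (if e = (k, m) then of_int w else 0)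
      + (if e = (k, long_side m r) then of_int w * sqrt 3 else 0) + (if e = (k, hyp_side m r) then 2 * of_int w else 0)" for e
    using sides_distinct[OF m, of r]
    by (cases e; cases "coefficient ps e") (auto simp: p ring_value_def algebra_simps)
  have "(\<Sum>e\<in>E. ring_value (coefficient (p # ps) e) * f e) = (\<Sum>e\<in>E. ring_value (coefficient ps e) * f e
      + (if e = (k, m) then of_int w * f (k, m) else 0)
      + (if e = (k, long_side m r) then of_int w * sqrt 3 * f (k, long_side m r) else 0)
      + (if e = (k, hyp_side m r) then 2 * of_int w * f (k, hyp_side m r) else 0))"
    unfolding q by (intro sum.cong refl) (auto simp: algebra_simps)
  also have "\<dots> = (\<Sum>e\<in>E. ring_value (coefficient ps e) * f e) + of_int w * width f (k, m, r)"
    using sub \<open>finite E\<close> by (simp add: sum.distrib algebra_simps)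
  also have "(\<Sum>e\<in>E. ring_value (coefficient ps e) * f e) = (\<Sum>(k, m, r, w)\<leftarrow>ps. of_int w * width f (k, m, r))"
    using Cons.prems(3) sub by (intro Cons.IH \<open>finite E\<close>) auto
  finally show ?case by (simp add: p)
qed

lemma distinct_used_directions: "distinct (used_directions ps)"
  by (induction ps rule: used_directions.induct) simp_all

text \<open>
  An arc in coordinates whose first axis points along its chord. The time \<open>\<tau> e\<close> is meant to be one at which the arc is
  extremal in direction \<open>e\<close>, so that \<open>wide\<close> says that no placement covers the arc.
\<close>

locale wide_curve =
  fixes g :: "real \<Rightarrow> real \<times> real" and \<tau> :: "dir \<Rightarrow> real"
  assumes \<tau>_range: "0 \<le> \<tau> e" "\<tau> e \<le> 1"
    and short: "sorted ts \<Longrightarrow> set ts \<subseteq> {0..1} \<Longrightarrow>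
      (\<Sum>i<length ts - 1. dist (g (ts ! i)) (g (ts ! Suc i))) \<le> 1"
    and chord: "snd (g 0) = snd (g 1)" "fst (g 0) \<le> fst (g 1)"
    and wide: "0 \<le> m \<Longrightarrow> m < 12 \<Longrightarrow>
      beta * norm (normal (k, m)) < width (\<lambda>e. normal e \<bullet> g (\<tau> e)) (k, m, r)"
begin

text \<open>
  The sweep bounds all partial sums by \<open>total_bound ps / 10\<^sup>5\<close>. By \<open>abel_polygon\<close> the weighted sum of the widths is at most
  this number, but \<open>wide\<close> and \<open>width_bound_le\<close> make it larger.
\<close>

lemma no_leaf:
  assumes R: "\<And>x y. (x, y) \<in> set R \<Longrightarrow> \<tau> x \<le> \<tau> y"
  shows "\<not> refutes R (Leaf ps l \<mu>)"
proof
  assume c: "refutes R (Leaf ps l \<mu>)"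
  define E where "E = set (used_directions ps)"
  define u :: "real \<times> real" where "u = point (- \<mu>, 0, l, 0)"
  define B where "B = total_bound ps"
  have \<mu>: "0 \<le> \<mu>" and ps: "ps \<noteq> []"
    and ok: "\<And>k m r w. (k, m, r, w) \<in> set ps \<Longrightarrow> 0 < w \<and> 0 \<le> m \<and> m < 12"
    and sw: "sweep (B\<^sup>2) (events R ps) [] [] (- \<mu>, 0, l, 0)"
    using c by (auto simp: B_def)
  have finE: "finite E" by (simp add: E_def)
  have nonneg: "0 \<le> width_bound k" for k by simp
  have "\<forall>p\<in>set ps. 0 < snd (snd (snd p))" using ok by auto
  then have B0: "0 \<le> B"
    unfolding B_def by (induction ps rule: total_bound.induct) (simp_all add: nonneg del: width_bound.simps)
  have expand: "(\<Sum>e\<in>E. (ring_value (coefficient ps e) *\<^sub>R normal e) \<bullet> h e)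
      = (\<Sum>(k, m, r, w)\<leftarrow>ps. of_int w * width (\<lambda>e. normal e \<bullet> h e) (k, m, r))" for h
    unfolding inner_scaleR_left by (rule weighted_widths) (use ok finE in \<open>auto simp: E_def\<close>)
  \<comment> \<open>The vectors add up to zero because widths are invariant under translations.\<close>
  have "(\<Sum>e\<in>E. ring_value (coefficient ps e) *\<^sub>R normal e) \<bullet> x = 0" for x
  proof -
    have "(\<Sum>(k, m, r, w)\<leftarrow>ps. of_int w * width (\<lambda>e. normal e \<bullet> x) (k, m, r)) = (\<Sum>p\<leftarrow>ps. 0)"
      using ok by (intro arg_cong[where f = sum_list] map_cong refl)
        (auto simp: width_constant simp del: width.simps)
    then show ?thesis using expand[of "\<lambda>_. x"] by (simp add: inner_sum_left)
  qed
  then have zero: "(\<Sum>e\<in>E. ring_value (coefficient ps e) *\<^sub>R normal e) = 0"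
    using inner_eq_zero_iff by blast
  have "(\<Sum>e\<in>E. (ring_value (coefficient ps e) *\<^sub>R normal e) \<bullet> g (\<tau> e)) + u \<bullet> g 0
      \<le> (u + (\<Sum>e\<in>E. ring_value (coefficient ps e) *\<^sub>R normal e)) \<bullet> g 1 + of_int B / 10^5"
  proof (rule abel_polygon)
    fix s
    define D where "D = {e. \<tau> e \<le> s}"
    have "norm (point (- \<mu>, 0, l, 0) + (\<Sum>(e, _, _, c)\<leftarrow>events R ps. if e \<in> D then point c else 0)) \<le> of_int B / 10^5"
    proof (rule sweep_sound[OF sw B0])
      fix e before after c x
      assume ev: "(e, before, after, c) \<in> set (events R ps)"
      show "x \<in> D" if "x \<in> set before" "e \<in> D"
        using R[of x e] ev that by (auto simp: events_def D_def)
      show "e \<in> D" if "x \<in> set after" "x \<in> D"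
        using R[of e x] ev that by (auto simp: events_def D_def)
    qed simp_all
    also have "(\<Sum>(e, _, _, c)\<leftarrow>events R ps. if e \<in> D then point c else 0)
        = (\<Sum>e\<leftarrow>used_directions ps. if \<tau> e \<le> s then ring_value (coefficient ps e) *\<^sub>R normal e else 0)"
      by (simp add: events_def D_def comp_def point_zscale normal_def cong: if_cong)
    also have "\<dots> = (\<Sum>e\<in>E. if \<tau> e \<le> s then ring_value (coefficient ps e) *\<^sub>R normal e else 0)"
      unfolding E_def by (rule sum_list_distinct_conv_sum_set[OF distinct_used_directions])
    also have "\<dots> = (\<Sum>e\<in>{e\<in>E. \<tau> e \<le> s}. ring_value (coefficient ps e) *\<^sub>R normal e)"
      by (rule sum.inter_filter[OF finE, symmetric])
    finally show "norm (u + (\<Sum>e\<in>{e\<in>E. \<tau> e \<le> s}. ring_value (coefficient ps e) *\<^sub>R normal e)) \<le> of_int B / 10^5"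
      unfolding u_def .
  qed (use finE \<tau>_range short in auto)
  moreover have "0 \<le> u \<bullet> (g 0 - g 1)"
  proof -
    have "u \<bullet> (g 0 - g 1) = of_int \<mu> * (fst (g 1) - fst (g 0))"
      using chord by (simp add: u_def inner_prod_def algebra_simps)
    then show ?thesis using \<mu> chord by simp
  qed
  ultimately have "(\<Sum>(k, m, r, w)\<leftarrow>ps. of_int w * width (\<lambda>e. normal e \<bullet> g (\<tau> e)) (k, m, r)) \<le> of_int B / 10^5"
    unfolding expand zero by (simp add: inner_diff_right)
  moreover have "of_int (total_bound ps) / 10^5
      < (\<Sum>(k, m, r, w)\<leftarrow>ps. of_int w * width (\<lambda>e. normal e \<bullet> g (\<tau> e)) (k, m, r))"
  proof -
    have each: "of_int (w * width_bound k) / 10^5 < of_int w * width (\<lambda>e. normal e \<bullet> g (\<tau> e)) (k, m, r)"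
      if "(k, m, r, w) \<in> set ps" for k m r w
    proof -
      have m: "0 \<le> m" "m < 12" and w: "0 < w" using ok[OF that] by auto
      have "of_int (width_bound k) / 10^5 \<le> beta * norm (normal (k, m))"
        using width_bound_le[of k] normal_sides(3)[OF m, of k] normal_sides(3)[of 0 k] by simp
      also have "\<dots> < width (\<lambda>e. normal e \<bullet> g (\<tau> e)) (k, m, r)" by (rule wide[OF m])
      finally have "of_int w * (of_int (width_bound k) / 10^5) < of_int w * width (\<lambda>e. normal e \<bullet> g (\<tau> e)) (k, m, r)"
        using w by (intro mult_strict_left_mono) simp_all
      then show ?thesis by (simp only: of_int_mult times_divide_eq_right)
    qed
    show ?thesis
      using ps each
    proof (induction ps rule: list_nonempty_induct)
      case (single p)
      obtain k m r w where p: "p = (k, m, r, w)" by (cases p)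
      show ?case using single(1)[of k m r w] by (simp add: p del: width.simps width_bound.simps)
    next
      case (cons p ps)
      obtain k m r w where p: "p = (k, m, r, w)" by (cases p)
      have "of_int (total_bound ps) / 10^5
        < (\<Sum>(k, m, r, w)\<leftarrow>ps. of_int w * width (\<lambda>e. normal e \<bullet> g (\<tau> e)) (k, m, r))"
        by (rule cons.IH) (use cons.prems in auto)
      then show ?case using cons.prems[of k m r w]
        by (simp add: p add_divide_distrib del: width.simps width_bound.simps)
    qed
  qed
  ultimately show False by (simp add: B_def)
qed

lemma no_certificate:
  assumes "\<And>x y. (x, y) \<in> set R \<Longrightarrow> \<tau> x \<le> \<tau> y"
  shows "\<not> refutes R T"
  using assms
proof (induction T arbitrary: R)
  case (Split e f A B)
  consider "\<tau> e \<le> \<tau> f" | "\<tau> f \<le> \<tau> e" by linarith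
  then show ?case
  proof cases
    case 1
    with Split.prems have "\<not> refutes ((e, f) # R) A" by (intro Split.IH) auto
    then show ?thesis by simp
  next
    case 2
    with Split.prems have "\<not> refutes ((f, e) # R) B" by (intro Split.IH) auto
    then show ?thesis by simp
  qed
next
  case (Leaf ps l m)
  then show ?case by (rule no_leaf)
qed

end

section \<open>The certificate\<close>

text \<open>
  The tree comes from a numerical search. At each node the shortest polygon with all widths of the current
  placements above \<open>\<beta>\<close> and the current order constraints is computed together with its dual weights. If it is
  not longer than 1, either two touching times that are not yet ordered are compared, or a placement that covers the
  polygon is added.
\<close>

definition touching_order_tree :: certificate where "touching_order_tree =
(Split (0, 9) (0, 2)
 (Split (0, 9) (0, 5)
  (Split (0, 2) (0, 7)
   (Split (0, 5) (0, 0)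
    (Leaf [(0, 5, False, 2), (0, 4, True, 1)] 51 9)
    (Leaf [(0, 5, False, 6), (0, 4, True, 2)] 151 64))
   (Split (0, 9) (0, 0)
    (Split (0, 2) (0, 4)
     (Split (0, 4) (0, 0)
      (Split (0, 4) (-4, 9)
       (Leaf [(0, 5, False, 10), (0, 0, False, 4), (-4, 9, False, 2)] 385 0)
       (Leaf [(0, 5, False, 203), (0, 4, True, 8), (0, 0, False, 81), (-4, 9, False, 23)] 8852 0))
      (Leaf [(0, 5, False, 12), (0, 4, True, 3), (0, 0, False, 6)] 610 0))
     (Split (0, 4) (0, 10)
      (Split (0, 5) (0, 10)
       (Leaf [(0, 5, False, 6), (0, 7, True, 5)] 14 0)
       (Leaf [(0, 5, False, 7), (0, 4, True, 2), (0, 7, True, 7)] (-20) 0))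
      (Leaf [(0, 5, False, 7), (0, 4, True, 3), (0, 0, False, 2), (0, 7, True, 4)] 188 0)))
    (Split (0, 4) (0, 7)
     (Leaf [(0, 5, False, 4), (0, 4, True, 1)] 119 20)
     (Leaf [(0, 5, False, 6), (0, 4, True, 2)] 199 0))))
  (Split (0, 3) (0, 8)
   (Split (0, 11) (0, 8)
    (Split (0, 3) (0, 11)
     (Split (0, 2) (0, 8)
      (Split (0, 11) (0, 6)
       (Leaf [(0, 11, False, 3), (0, 2, False, 5)] (-141) 174)
       (Split (0, 2) (4, 9)
        (Leaf [(0, 11, False, 8), (0, 2, False, 2), (4, 9, True, 1)] (-291) 0)
        (Leaf [(0, 11, False, 13), (0, 2, False, 2), (4, 9, True, 1)] (-434) 0)))
      (Split (0, 11) (0, 6)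
       (Leaf [(0, 11, False, 3), (0, 2, False, 5)] 7 105)
       (Leaf [(0, 11, False, 4), (0, 2, False, 1)] (-118) 0)))
     (Leaf [(0, 5, False, 1), (0, 11, False, 2)] (-36) 0))
    (Split (0, 3) (0, 10)
     (Split (0, 2) (0, 8)
      (Leaf [(0, 5, False, 2), (0, 11, False, 2)] (-96) 0)
      (Split (0, 6) (0, 10)
       (Split (0, 3) (0, 7)
        (Split (0, 8) (-4, 3)
         (Split (0, 3) (-4, 10)
          (Split (0, 8) (-2, 3)
           (Split (0, 3) (-2, 7)
            (Leaf [(0, 11, False, 118), (0, 6, False, 39), (-2, 3, False, 15), (0, 7, True, 75), (0, 0, True, 16)] (-7497) 0)
            (Leaf [(0, 11, False, 12), (-4, 7, True, 1), (-2, 3, False, 2), (0, 7, True, 16)] (-816) 0))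
           (Leaf [(0, 11, False, 148), (0, 6, False, 31), (-4, 7, True, 20), (-2, 3, False, 24), (0, 7, True, 93)] (-8329) 0))
          (Leaf [(0, 11, False, 1), (-4, 7, True, 1)] 27 0))
         (Split (-4, 10) (-4, 3)
          (Leaf [(0, 11, False, 2), (0, 10, False, 1), (-4, 7, True, 1)] (-36) 0)
          (Leaf [(0, 11, False, 8), (0, 6, False, 6), (0, 10, False, 2), (0, 3, False, 1), (-4, 7, True, 4)] (-519) 0)))
        (Leaf [(0, 11, False, 68), (0, 10, False, 10), (0, 7, True, 17)] (-2170) 0))
       (Leaf [(0, 11, False, 10), (0, 2, False, 2), (0, 6, False, 3)] (-354) 0)))
     (Leaf [(0, 11, False, 4), (0, 2, False, 1), (0, 6, False, 1)] (-113) 0)))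
   (Split (0, 3) (0, 11)
    (Split (0, 3) (-3, 10)
     (Split (0, 9) (-3, 3)
      (Split (-3, 10) (-3, 3)
       (Split (-3, 10) (-4, 4)
        (Leaf [(0, 5, False, 15), (0, 11, False, 19), (-3, 7, True, 9), (-4, 1, True, 9)] 571 0)
        (Split (0, 3) (-4, 9)
         (Leaf [(0, 11, False, 15), (-3, 7, True, 18), (-4, 1, True, 8)] 114 0)
         (Split (0, 8) (-4, 4)
          (Split (-3, 10) (-2, 4)
           (Leaf [(0, 5, False, 3), (0, 11, False, 3), (-3, 7, True, 4), (-4, 1, True, 4), (-2, 1, True, 2)] 225 0)
           (Split (0, 3) (-2, 9)
            (Split (-2, 9) (-2, 3)
             (Leaf [(0, 11, False, 19), (-3, 7, True, 19), (-2, 1, True, 13), (-2, 11, False, 13)] 496 0)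
             (Leaf [(0, 11, False, 189), (-3, 7, True, 730), (-4, 1, True, 345), (-2, 1, True, 252), (-2, 11, False, 141)] 10929 0))
            (Leaf [(0, 11, False, 3), (-3, 7, True, 9), (-2, 1, True, 4)] 206 0)))
          (Leaf [(0, 5, False, 1), (0, 11, False, 3), (-3, 7, True, 7), (-4, 1, True, 5)] 149 0))))
       (Leaf [(0, 5, False, 1), (0, 11, False, 5), (-3, 7, True, 7), (0, 1, True, 4)] (-47) 0))
      (Split (0, 9) (-4, 4)
       (Leaf [(0, 5, False, 123), (0, 11, False, 117), (-3, 7, True, 7), (-4, 1, True, 67)] 2599 0)
       (Split (-4, 4) (-4, 9)
        (Split (-3, 3) (-4, 9)
         (Split (-4, 4) (4, 9)
          (Split (-4, 9) (4, 2)
           (Split (0, 3) (-4, 9)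
            (Split (0, 3) (4, 9)
             (Split (-3, 10) (4, 2)
              (Split (-4, 9) (-4, 3)
               (Split (-4, 4) (-4, 8)
                (Leaf [(0, 11, False, 4), (-3, 7, True, 4), (-4, 1, True, 5), (-4, 11, False, 3)] (-146) 0)
                (Split (-3, 3) (-4, 11)
                 (Split (-3, 10) (-4, 4)
                  (Leaf [(0, 11, False, 1), (-3, 7, True, 1), (-4, 1, True, 2), (4, 6, True, 1), (-4, 11, False, 1)] 19 0)
                  (Leaf [(0, 11, False, 172), (-3, 7, True, 1151), (-4, 1, True, 1390), (-4, 11, False, 1388)] (-7722) 0))
                 (Leaf [(0, 11, False, 2), (-3, 7, True, 2), (-4, 1, True, 5), (-4, 11, False, 2)] (-33) 0)))
               (Split (-4, 8) (-4, 3)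
                (Leaf [(0, 11, False, 36), (-3, 7, True, 7), (-4, 1, True, 72), (4, 6, True, 90), (-4, 11, False, 51)] (-517) 0)
                (Leaf [(0, 11, False, 2), (-4, 1, True, 2), (4, 6, True, 2), (-4, 11, False, 1)] (-22) 0)))
              (Leaf [(0, 5, False, 3), (-3, 7, True, 6), (-4, 1, True, 4), (4, 6, True, 3)] (-253) 0))
             (Leaf [(0, 11, False, 2), (-4, 1, True, 2), (4, 6, True, 1)] 6 0))
            (Leaf [(0, 5, False, 1), (0, 11, False, 1), (-3, 7, True, 1), (-4, 1, True, 1)] (-26) 0))
           (Split (4, 9) (4, 2)
            (Leaf [(-4, 1, True, 1), (4, 6, True, 1)] (-41) 0)
            (Split (4, 2) (4, 8)
             (Split (4, 1) (4, 8)
              (Leaf [(0, 5, False, 1), (0, 11, False, 1), (4, 4, False, 1)] (-13) 0)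
              (Split (0, 3) (4, 8)
               (Split (4, 4) (4, 8)
                (Split (4, 2) (4, 7)
                 (Leaf [(0, 11, False, 2), (4, 6, True, 1), (4, 4, False, 3), (4, 10, False, 2)] (-60) 0)
                 (Split (4, 2) (4, 10)
                  (Split (4, 8) (4, 3)
                   (Leaf [(0, 11, False, 2), (4, 6, True, 1), (4, 0, True, 2)] (-6) 0)
                   (Leaf [(4, 6, True, 259), (4, 4, False, 404), (4, 10, False, 404), (4, 0, True, 259)] (-15197) 0))
                  (Leaf [(-4, 1, True, 1), (4, 4, False, 2), (4, 10, False, 2)] 14 0)))
                (Leaf [(0, 11, False, 1), (4, 6, True, 1), (4, 4, False, 1)] 8 0))
               (Leaf [(0, 5, False, 3), (0, 11, False, 3), (-4, 1, True, 2), (4, 6, True, 7), (4, 4, False, 2)] (-163) 0)))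
             (Split (4, 9) (4, 1)
              (Split (4, 9) (4, 4)
               (Leaf [(4, 6, True, 1), (4, 4, False, 1)] 36 0)
               (Leaf [(0, 5, False, 3), (-4, 1, True, 11), (4, 6, True, 15), (4, 4, False, 12)] (-159) 0))
              (Leaf [(0, 5, False, 4), (0, 11, False, 1), (-4, 1, True, 6), (4, 6, True, 6), (4, 4, False, 3)] (-250) 0)))))
          (Split (4, 9) (4, 2)
           (Leaf [(0, 5, False, 149), (0, 11, False, 167), (-3, 7, True, 39), (-4, 1, True, 67), (4, 6, True, 199)] 5181 0)
           (Leaf [(0, 5, False, 1), (0, 11, False, 1), (-4, 1, True, 1), (4, 6, True, 1)] (-10) 0)))
         (Leaf [(0, 5, False, 5), (0, 11, False, 1), (-3, 7, True, 4), (-4, 1, True, 5)] (-54) 0))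
        (Split (-3, 10) (-4, 4)
         (Leaf [(0, 5, False, 3), (0, 11, False, 1), (-3, 7, True, 1), (-4, 1, True, 3)] 81 0)
         (Split (0, 9) (-3, 4)
          (Leaf [(0, 5, False, 7), (-3, 7, True, 3), (-4, 1, True, 7), (-3, 1, True, 3)] 181 0)
          (Split (-3, 3) (-3, 9)
           (Split (-4, 9) (-3, 2)
            (Split (-3, 9) (-3, 2)
             (Split (-4, 4) (-4, 10)
              (Split (-3, 9) (-4, 3)
               (Leaf [(-3, 7, True, 9), (-4, 1, True, 15), (-3, 5, False, 9), (-4, 7, True, 7)] 138 0)
               (Leaf [(0, 5, False, 5), (-4, 1, True, 37), (-3, 5, False, 31), (-4, 7, True, 30)] (-101) 0))
              (Leaf [(0, 5, False, 22), (-3, 7, True, 9), (-4, 1, True, 27), (-4, 7, True, 4)] 416 0))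
             (Leaf [(0, 5, False, 1), (-3, 7, True, 1), (-4, 1, True, 2), (-3, 5, False, 2)] (-26) 0))
            (Leaf [(0, 5, False, 4), (-3, 7, True, 1), (-4, 1, True, 5), (-3, 5, False, 1)] 61 0))
           (Split (-3, 4) (-3, 9)
            (Leaf [(0, 5, False, 5), (-3, 7, True, 4), (-4, 1, True, 3), (-3, 1, True, 4)] (-17) 0)
            (Split (-3, 10) (-3, 4)
             (Leaf [(0, 5, False, 1), (-3, 7, True, 1), (-3, 1, True, 1)] 51 0)
             (Leaf [(0, 5, False, 33), (-3, 7, True, 13), (-3, 1, True, 47)] 473 0)))))))))
     (Leaf [(0, 5, False, 25), (0, 11, False, 25), (-3, 7, True, 14)] 542 0))
    (Leaf [(0, 5, False, 1), (0, 11, False, 3)] 80 0))))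
 (Split (0, 9) (0, 5)
  (Split (0, 5) (0, 0)
   (Leaf [(0, 5, False, 3), (0, 8, False, 2)] (-24) 0)
   (Leaf [(0, 5, False, 255), (0, 8, False, 61)] (-3414) 7161))
  (Split (0, 2) (0, 8)
   (Split (0, 5) (0, 0)
    (Split (0, 9) (0, 4)
     (Leaf [(0, 5, False, 5), (0, 8, False, 1), (0, 0, False, 1)] (-147) 0)
     (Split (0, 2) (0, 11)
      (Split (0, 11) (4, 3)
       (Leaf [(0, 5, False, 9), (0, 8, False, 2), (0, 11, False, 4), (4, 3, True, 1)] (-427) 0)
       (Leaf [(0, 5, False, 21), (0, 8, False, 4), (0, 11, False, 6), (4, 3, True, 1)] (-918) 0))
      (Leaf [(0, 5, False, 3), (0, 8, False, 2), (0, 11, False, 2)] (-163) 0)))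
    (Leaf [(0, 5, False, 3), (0, 8, False, 5)] (-141) 174))
   (Split (0, 9) (0, 4)
    (Split (0, 5) (0, 1)
     (Leaf [(0, 5, False, 4), (0, 8, False, 2), (0, 1, True, 2)] (-62) 0)
     (Leaf [(0, 5, False, 3), (0, 8, False, 4), (0, 1, True, 25)] 334 445))
    (Split (0, 9) (0, 1)
     (Leaf [(0, 5, False, 258), (0, 8, False, 16), (0, 1, True, 106), (0, 0, True, 41)] (-9958) 0)
     (Split (0, 0) (0, 1)
      (Split (0, 0) (0, 4)
       (Leaf [(0, 5, False, 1), (0, 8, False, 1), (0, 1, True, 5)] (-173) 25)
       (Leaf [(0, 5, False, 57), (0, 1, True, 18), (0, 9, True, 7), (0, 0, False, 13)] (-2880) 0))
      (Split (0, 1) (0, 6)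
       (Leaf [(0, 1, True, 3), (0, 9, False, 5)] (-181) 132)
       (Split (0, 4) (2, 9)
        (Split (0, 1) (2, 5)
         (Leaf [(0, 5, False, 3), (0, 1, True, 4), (0, 9, False, 2), (2, 9, True, 2)] (-258) 0)
         (Split (2, 9) (2, 0)
          (Leaf [(0, 5, False, 150), (0, 1, True, 262), (2, 9, True, 34), (0, 0, True, 3), (0, 6, True, 78)] (-15643) 0)
          (Leaf [(0, 5, False, 182), (0, 1, True, 274), (2, 9, True, 35), (0, 6, True, 101), (0, 0, False, 39)] (-18928) 0)))
        (Leaf [(0, 5, False, 193), (0, 1, True, 186), (0, 9, False, 3), (2, 9, True, 38)] (-11566) 0)))))))))"

lemma touching_order_tree_refutes: "refutes [((0, 3), (0, 9))] touching_order_tree"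
  by code_simp

section \<open>From widths to coverings\<close>

lemma orthonormal_plane:
  fixes u w x :: "real^2"
  assumes "norm u = 1" "norm w = 1" "u \<bullet> w = 0"
  shows "(x \<bullet> u)\<^sup>2 + (x \<bullet> w)\<^sup>2 = (norm x)\<^sup>2" "(x \<bullet> u) *\<^sub>R u + (x \<bullet> w) *\<^sub>R w = x"
proof -
  have i: "y \<bullet> z = y$1 * z$1 + y$2 * z$2" for y z :: "real^2" by (simp add: inner_vec_def sum_2)
  have 1: "u$1 * u$1 + u$2 * u$2 = 1" "w$1 * w$1 + w$2 * w$2 = 1" "u$1 * w$1 + u$2 * w$2 = 0"
    using assms by (simp_all add: norm_eq_1 i)
  have "u$1 * u$1 + w$1 * w$1 = 1" "u$2 * u$2 + w$2 * w$2 = 1" "u$1 * u$2 + w$1 * w$2 = 0"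
    using 1 by algebra+
  then have "(x$1 * u$1 + x$2 * u$2) * u$1 + (x$1 * w$1 + x$2 * w$2) * w$1 = x$1"
    "(x$1 * u$1 + x$2 * u$2) * u$2 + (x$1 * w$1 + x$2 * w$2) * w$2 = x$2" by algebra+
  then show e: "(x \<bullet> u) *\<^sub>R u + (x \<bullet> w) *\<^sub>R w = x"
    by (simp add: vec_eq_iff forall_2 i)
  have "(norm x)\<^sup>2 = x \<bullet> ((x \<bullet> u) *\<^sub>R u + (x \<bullet> w) *\<^sub>R w)"
    unfolding e by (rule power2_norm_eq_inner)
  then show "(x \<bullet> u)\<^sup>2 + (x \<bullet> w)\<^sup>2 = (norm x)\<^sup>2"
    by (simp add: inner_add_right power2_eq_square)
qed

text \<open>
  The isometry \<open>f\<close> sends the right angle to the corner \<open>M1 U + M2 W\<close> of the two supporting lines and the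
  legs to the directions \<open>- U\<close> and \<open>- W\<close>. The hypotenuse then lies beyond the third supporting line exactly if the size condition
  holds.
\<close>

lemma right_triangle_fits:
  fixes A B C U W :: "real^2"
  assumes perp: "(A - C) \<bullet> (B - C) = 0" and a: "norm (B - C) = a" "0 < a"
    and b: "norm (A - C) = b" "b = sqrt 3 * a"
    and UW: "norm U = 1" "norm W = 1" "U \<bullet> W = 0"
    and K: "\<And>p. p \<in> K \<Longrightarrow> p \<bullet> U \<le> M1" "\<And>p. p \<in> K \<Longrightarrow> p \<bullet> W \<le> M2"
      "\<And>p. p \<in> K \<Longrightarrow> - (p \<bullet> U) - sqrt 3 * (p \<bullet> W) \<le> M3"
    and size: "M1 + sqrt 3 * M2 + M3 \<le> b"
  shows "\<exists>Y. congruent_copy (convex hull {A, B, C}) Y \<and> K \<subseteq> Y"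
proof -
  have b0: "0 < b" using a b by simp
  define u w where "u = (A - C) /\<^sub>R b" and "w = (B - C) /\<^sub>R a"
  have uw: "norm u = 1" "norm w = 1" "u \<bullet> w = 0"
    using a b(1) b0 perp by (simp_all add: u_def w_def)
  have AB: "A = C + b *\<^sub>R u" "B = C + a *\<^sub>R w"
    using a b0 by (simp_all add: u_def w_def)
  define f where "f x = (M1 - (x - C) \<bullet> u) *\<^sub>R U + (M2 - (x - C) \<bullet> w) *\<^sub>R W" for x
  have "dist (f x) (f y) = dist x y" for x y
  proof -
    define z where "z = y - x"
    have "f x - f y = (z \<bullet> u) *\<^sub>R U + (z \<bullet> w) *\<^sub>R W"
      by (simp add: f_def z_def inner_diff_left algebra_simps)
    moreover have "U \<bullet> U = 1" "W \<bullet> W = 1" "W \<bullet> U = 0"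
      using UW by (simp_all add: norm_eq_1 inner_commute)
    ultimately have "(norm (f x - f y))\<^sup>2 = (z \<bullet> u)\<^sup>2 + (z \<bullet> w)\<^sup>2"
      unfolding power2_norm_eq_inner
      by (simp only: inner_add_left inner_add_right inner_scaleR_left inner_scaleR_right UW(3)) (simp add: power2_eq_square)
    also have "\<dots> = (norm z)\<^sup>2" by (rule orthonormal_plane(1)[OF uw])
    finally have "norm (f x - f y) = norm z" by (rule power2_eq_imp_eq) simp_all
    then show ?thesis by (simp add: z_def dist_norm norm_minus_commute)
  qed
  then have iso: "plane_isometry f" by (simp add: plane_isometry_def)
  have "p \<in> f ` (convex hull {A, B, C})" if p: "p \<in> K" for p
  proof
    define s t where "s = M1 - p \<bullet> U" and "t = M2 - p \<bullet> W"
    have st: "0 \<le> s" "0 \<le> t" "s + sqrt 3 * t \<le> b"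
      using K[OF p] size by (simp_all add: s_def t_def algebra_simps)
    define z where "z = C + s *\<^sub>R u + t *\<^sub>R w"
    have "(z - C) \<bullet> u = s" "(z - C) \<bullet> w = t"
      using uw by (simp_all add: z_def inner_add_left norm_eq_1 inner_commute[of w u])
    then show "p = f z"
      using orthonormal_plane(2)[OF UW, of p] by (simp add: f_def s_def t_def)
    have "s / b + t / a \<le> 1"
    proof -
      have "t / a = sqrt 3 * t / b" using b a by simp
      then have "s / b + t / a = (s + sqrt 3 * t) / b" by (simp add: add_divide_distrib)
      then show ?thesis using st b0 by simp
    qed
    moreover have "z = (s / b) *\<^sub>R A + (t / a) *\<^sub>R B + (1 - s / b - t / a) *\<^sub>R C"
      using a b0 by (simp add: z_def AB algebra_simps)
    moreover have "0 \<le> s / b" "0 \<le> t / a" using st a b0 by simp_all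
    ultimately show "z \<in> convex hull {A, B, C}"
      unfolding convex_hull_3 by (intro CollectI exI[of _ "s / b"] exI[of _ "t / a"] exI[of _ "1 - s / b - t / a"]) auto
  qed
  then show ?thesis using iso unfolding congruent_copy_def by blast
qed

lemma short_polygons:
  assumes "curve_length \<gamma> = 1" "sorted ts" "set ts \<subseteq> {0..1}"
  shows "(\<Sum>i<length ts - 1. dist (\<gamma> (ts ! i)) (\<gamma> (ts ! Suc i))) \<le> 1"
proof -
  have "ennreal (\<Sum>i<length ts - 1. dist (\<gamma> (ts ! i)) (\<gamma> (ts ! Suc i))) \<le> curve_length \<gamma>"
    unfolding curve_length_def by (rule SUP_upper) (use assms in auto)
  then show ?thesis using assms(1) by (simp add: ennreal_le_1)
qed

lemma touching_times:
  fixes G :: "real \<Rightarrow> real \<times> real"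
  assumes "continuous_on {0..1} G"
  obtains \<tau> where "\<And>e. \<tau> e \<in> {0..1}" "\<And>e t. t \<in> {0..1} \<Longrightarrow> normal e \<bullet> G t \<le> normal e \<bullet> G (\<tau> e)"
proof -
  have "\<exists>s\<in>{0..1}. \<forall>t\<in>{0..1}. normal e \<bullet> G t \<le> normal e \<bullet> G s" for e
    by (rule continuous_attains_sup) (auto intro!: continuous_intros assms)
  then show ?thesis using that by metis
qed

lemma turn_simps: "norm (turn r x) = norm x" "x \<bullet> turn r x = 0"
  by (cases x; cases r; simp add: norm_Pair add.commute)+

lemma covered_if_narrow:
  fixes A B C e1 e2 :: "real^2"
  assumes tri: "(A - C) \<bullet> (B - C) = 0" "norm (B - C) = a" "0 < a" "norm (A - C) = beta" "beta = sqrt 3 * a"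
    and e: "norm e1 = 1" "norm e2 = 1" "e1 \<bullet> e2 = 0"
    and touch: "\<And>d t. t \<in> {0..1} \<Longrightarrow> normal d \<bullet> (\<gamma> t \<bullet> e1, \<gamma> t \<bullet> e2) \<le> h d"
    and m: "0 \<le> m" "m < 12"
    and narrow: "width h (k, m, r) \<le> beta * norm (normal (k, m))"
  shows "\<exists>Y. congruent_copy (convex hull {A, B, C}) Y \<and> \<gamma> ` {0..1} \<subseteq> Y"
proof -
  define n where "n = norm (normal (k, m))"
  have "0 < 256 + (real_of_int k)\<^sup>2" by (rule add_pos_nonneg) simp_all
  then have n0: "0 < n" unfolding n_def normal_sides(3)[OF m] by simp
  define \<Phi> where "\<Phi> v = (fst v *\<^sub>R e1 + snd v *\<^sub>R e2) /\<^sub>R n" for v :: "real \<times> real"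
  have ee: "e1 \<bullet> e1 = 1" "e2 \<bullet> e2 = 1" "e2 \<bullet> e1 = 0"
    using e by (simp_all add: norm_eq_1 inner_commute)
  have \<Phi>: "\<Phi> v \<bullet> \<Phi> w = (v \<bullet> w) / n\<^sup>2" for v w
    unfolding \<Phi>_def inner_scaleR_left inner_scaleR_right inner_add_left inner_add_right ee e
    by (simp add: inner_prod_def power2_eq_square divide_inverse algebra_simps)
  have dot: "p \<bullet> \<Phi> v = (v \<bullet> (p \<bullet> e1, p \<bullet> e2)) / n" for p v
    by (simp add: \<Phi>_def inner_add_right inner_prod_def divide_inverse mult.commute)
  define U W where "U = \<Phi> (normal (k, m))" and "W = \<Phi> (normal (k, long_side m r))"
  have nb: "norm (normal (k, long_side m r)) = n" "normal (k, m) \<bullet> normal (k, long_side m r) = 0"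
    unfolding normal_sides(1)[OF m] by (simp_all add: turn_simps n_def)
  have "U \<bullet> U = 1" "W \<bullet> W = 1" "U \<bullet> W = 0"
    using n0 nb unfolding U_def W_def \<Phi> by (simp_all add: n_def dot_square_norm)
  then have UW: "norm U = 1" "norm W = 1" "U \<bullet> W = 0" by (simp_all add: norm_eq_1)
  show ?thesis
  proof (rule right_triangle_fits[OF tri(1-5) UW])
    fix p assume "p \<in> \<gamma> ` {0..1}"
    then obtain t where t: "t \<in> {0..1}" "p = \<gamma> t" by blast
    show "p \<bullet> U \<le> h (k, m) / n" "p \<bullet> W \<le> h (k, long_side m r) / n"
      unfolding U_def W_def dot t(2) using touch[OF t(1)] n0 by (simp_all add: divide_right_mono)
    have "- (p \<bullet> U) - sqrt 3 * (p \<bullet> W)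
      = ((- normal (k, m) - sqrt 3 *\<^sub>R normal (k, long_side m r)) \<bullet> (p \<bullet> e1, p \<bullet> e2)) / n"
      unfolding U_def W_def dot inner_diff_left inner_minus_left inner_scaleR_left by (simp add: diff_divide_distrib)
    also have "\<dots> = 2 * (normal (k, hyp_side m r) \<bullet> (\<gamma> t \<bullet> e1, \<gamma> t \<bullet> e2)) / n"
      unfolding normal_sides(2)[OF m, symmetric] inner_scaleR_left t(2) ..
    also have "\<dots> \<le> 2 * h (k, hyp_side m r) / n"
      using touch[OF t(1)] n0 by (intro divide_right_mono mult_left_mono) simp_all
    finally show "- (p \<bullet> U) - sqrt 3 * (p \<bullet> W) \<le> 2 * h (k, hyp_side m r) / n" .
  next
    have "h (k, m) / n + sqrt 3 * (h (k, long_side m r) / n) + 2 * h (k, hyp_side m r) / n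
        = width h (k, m, r) / n" by (simp add: add_divide_distrib)
    also have "\<dots> \<le> beta" using narrow n0 by (simp add: n_def[symmetric] pos_divide_le_eq)
    finally show "h (k, m) / n + sqrt 3 * (h (k, long_side m r) / n) + 2 * h (k, hyp_side m r) / n \<le> beta" .
  qed
qed

lemma covered_in_frame:
  fixes A B C e1 e2 :: "real^2"
  assumes tri: "(A - C) \<bullet> (B - C) = 0" "norm (B - C) = a" "0 < a" "norm (A - C) = beta" "beta = sqrt 3 * a"
    and e: "norm e1 = 1" "norm e2 = 1" "e1 \<bullet> e2 = 0"
    and len: "curve_length \<gamma> = 1"
    and chord: "\<gamma> 1 - \<gamma> 0 = c *\<^sub>R e1" "0 \<le> c"
    and \<tau>: "\<And>d. \<tau> d \<in> {0..1}"
      "\<And>d t. t \<in> {0..1} \<Longrightarrow> normal d \<bullet> (\<gamma> t \<bullet> e1, \<gamma> t \<bullet> e2) \<le> normal d \<bullet> (\<gamma> (\<tau> d) \<bullet> e1, \<gamma> (\<tau> d) \<bullet> e2)"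
    and top_first: "\<tau> (0, 3) \<le> \<tau> (0, 9)"
    and cert: "refutes [((0, 3), (0, 9))] T"
  shows "\<exists>Y. congruent_copy (convex hull {A, B, C}) Y \<and> \<gamma> ` {0..1} \<subseteq> Y"
proof (rule ccontr)
  assume not: "\<not> ?thesis"
  define G where "G t = (\<gamma> t \<bullet> e1, \<gamma> t \<bullet> e2)" for t
  have dist_G: "dist (G s) (G t) = dist (\<gamma> s) (\<gamma> t)" for s t
  proof -
    have "(norm (G s - G t))\<^sup>2 = (norm (\<gamma> s - \<gamma> t))\<^sup>2"
      using orthonormal_plane(1)[OF e, of "\<gamma> s - \<gamma> t"]
      by (simp add: G_def norm_Pair inner_diff_left)
    then show ?thesis unfolding dist_norm by (rule power2_eq_imp_eq) simp_all
  qed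
  have ends: "\<gamma> 1 = \<gamma> 0 + c *\<^sub>R e1" using chord(1) by (simp add: algebra_simps)
  interpret wide_curve G \<tau>
  proof
    show "0 \<le> \<tau> d" "\<tau> d \<le> 1" for d using \<tau>(1)[of d] by auto
    show "(\<Sum>i<length ts - 1. dist (G (ts ! i)) (G (ts ! Suc i))) \<le> 1"
      if "sorted ts" "set ts \<subseteq> {0..1}" for ts
      unfolding dist_G by (rule short_polygons[OF len that])
    show "snd (G 0) = snd (G 1)" "fst (G 0) \<le> fst (G 1)"
      using e chord(2) by (simp_all add: G_def ends inner_add_left norm_eq_1)
    show "beta * norm (normal (k, m)) < width (\<lambda>d. normal d \<bullet> G (\<tau> d)) (k, m, r)"
      if "0 \<le> m" "m < 12" for k m r
    proof (rule ccontr)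
      assume "\<not> ?thesis"
      then have "width (\<lambda>d. normal d \<bullet> G (\<tau> d)) (k, m, r) \<le> beta * norm (normal (k, m))" by simp
      from covered_if_narrow[OF tri e _ that this, of \<gamma>] \<tau>(2) not show False by (simp add: G_def)
    qed
  qed
  have "\<not> refutes [((0, 3), (0, 9))] T"
    using top_first by (intro no_certificate) auto
  with cert show False by blast
qed

text \<open>
  The first axis \<open>e1\<close> points along the chord. The sign of the second axis is chosen such that the highest point comes
  before the lowest one, as the root of the tree requires.
\<close>

lemma unit_arc_covered:
  fixes A B C :: "real^2"
  assumes tri: "(A - C) \<bullet> (B - C) = 0" "norm (B - C) = a" "0 < a" "norm (A - C) = beta" "beta = sqrt 3 * a"
    and cert: "refutes [((0, 3), (0, 9))] T"
  shows "covers_unit_arcs (convex hull {A, B, C})"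
  unfolding covers_unit_arcs_def
proof (intro allI impI)
  fix \<Gamma> assume "unit_arc \<Gamma>"
  then obtain \<gamma> where \<gamma>: "arc \<gamma>" "\<Gamma> = \<gamma> ` {0..1}" "curve_length \<gamma> = 1"
    by (auto simp: unit_arc_def path_image_def)
  have cont: "continuous_on {0..1} \<gamma>" using \<gamma>(1) by (simp add: arc_def path_def)
  have "\<gamma> 1 \<noteq> \<gamma> 0" using arc_distinct_ends[OF \<gamma>(1)] by (simp add: pathstart_def pathfinish_def)
  define c where "c = norm (\<gamma> 1 - \<gamma> 0)"
  have c: "0 < c" using \<open>\<gamma> 1 \<noteq> \<gamma> 0\<close> by (simp add: c_def)
  define e1 :: "real^2" where "e1 = (\<gamma> 1 - \<gamma> 0) /\<^sub>R c"
  define e2 :: "real^2" where "e2 = vector [- e1 $ 2, e1 $ 1]"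
  have e1: "norm e1 = 1" using c by (simp add: e1_def c_def[symmetric])
  have e: "norm e1 = 1" "norm e2 = 1" "e1 \<bullet> e2 = 0"
    using e1 by (simp_all add: norm_eq_1 inner_vec_def sum_2 e2_def)
  have chord: "\<gamma> 1 - \<gamma> 0 = c *\<^sub>R e1" using c by (simp add: e1_def)
  define cov where "cov = (\<exists>Y. congruent_copy (convex hull {A, B, C}) Y \<and> \<gamma> ` {0..1} \<subseteq> Y)"
  obtain \<tau> where \<tau>: "\<And>d. \<tau> d \<in> {0..1}"
      "\<And>d t. t \<in> {0..1} \<Longrightarrow> normal d \<bullet> (\<gamma> t \<bullet> e1, \<gamma> t \<bullet> e2) \<le> normal d \<bullet> (\<gamma> (\<tau> d) \<bullet> e1, \<gamma> (\<tau> d) \<bullet> e2)"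
    by (rule touching_times[of "\<lambda>t. (\<gamma> t \<bullet> e1, \<gamma> t \<bullet> e2)"]) (auto intro!: continuous_intros cont)
  have cov
  proof (cases "\<tau> (0, 3) \<le> \<tau> (0, 9)")
    case True
    then show ?thesis unfolding cov_def
      using c by (intro covered_in_frame[OF tri e \<gamma>(3) chord _ \<tau> _ cert]) simp_all
  next
    case False
    have e': "norm e1 = 1" "norm (- e2) = 1" "e1 \<bullet> (- e2) = 0" using e by simp_all
    obtain \<sigma> where \<sigma>: "\<And>d. \<sigma> d \<in> {0..1}"
        "\<And>d t. t \<in> {0..1} \<Longrightarrow> normal d \<bullet> (\<gamma> t \<bullet> e1, \<gamma> t \<bullet> (- e2)) \<le> normal d \<bullet> (\<gamma> (\<sigma> d) \<bullet> e1, \<gamma> (\<sigma> d) \<bullet> (- e2))"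
      by (rule touching_times[of "\<lambda>t. (\<gamma> t \<bullet> e1, \<gamma> t \<bullet> (- e2))"]) (auto intro!: continuous_intros cont)
    \<comment> \<open>The reflection exchanges the highest and the lowest point; for these two the old touching times are kept,
      because they are known to be in the right order.\<close>
    define \<rho> where "\<rho> = \<sigma>((0, 3) := \<tau> (0, 9), (0, 9) := \<tau> (0, 3))"
    have v: "normal (0, 3) = (0, 32)" "normal (0, 9) = (0, - 32)"
      by (simp_all add: normal_def cos2_def wrap_def)
    have \<rho>1: "\<And>d. \<rho> d \<in> {0..1}" using \<tau>(1) \<sigma>(1) by (simp add: \<rho>_def)
    have \<rho>2: "normal d \<bullet> (\<gamma> t \<bullet> e1, \<gamma> t \<bullet> (- e2)) \<le> normal d \<bullet> (\<gamma> (\<rho> d) \<bullet> e1, \<gamma> (\<rho> d) \<bullet> (- e2))"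
      if "t \<in> {0..1}" for d t
      using \<sigma>(2)[OF that, of d] \<tau>(2)[OF that, of "(0, 3)"] \<tau>(2)[OF that, of "(0, 9)"]
      by (cases "d = (0, 3)"; cases "d = (0, 9)") (simp_all add: \<rho>_def v)
    show ?thesis unfolding cov_def
      by (rule covered_in_frame[OF tri e' \<gamma>(3) chord _ \<rho>1 \<rho>2 _ cert]) (use c False in \<open>simp_all add: \<rho>_def\<close>)
  qed
  then show "\<exists>Y. congruent_copy (convex hull {A, B, C}) Y \<and> \<Gamma> \<subseteq> Y" by (simp add: cov_def \<gamma>(2))
qed

section \<open>Areas\<close>

text \<open>
  The difference between the arctangent and a Taylor polynomial has the one-term derivative
  \<open>\<plusminus> y\<^sup>n / (1 + y\<^sup>2)\<close>, so it is monotone.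
\<close>

lemma arctan_bounds:
  fixes x :: real
  assumes "0 \<le> x"
  shows "x - x^3 / 3 + x^5 / 5 - x^7 / 7 \<le> arctan x" (is "?l x \<le> _")
    and "arctan x \<le> x - x^3 / 3 + x^5 / 5 - x^7 / 7 + x^9 / 9" (is "_ \<le> ?u x")
    and "x - x^3 / 3 \<le> arctan x" (is "?k x \<le> _")
    and "arctan x \<le> x"
proof -
  have p: "1 + y\<^sup>2 > 0" for y :: real by (rule add_pos_nonneg) simp_all
  have ne: "1 + y\<^sup>2 \<noteq> 0" for y :: real using p[of y] by simp
  have mono: "f 0 \<le> f x"
    if "\<And>y. (f has_real_derivative d y / (1 + y\<^sup>2)) (at y)" "\<And>y. 0 \<le> d y" for f d
    by (rule DERIV_nonneg_imp_nondecreasing[OF assms]) (use that p in \<open>force intro: divide_nonneg_pos\<close>)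
  have "((\<lambda>y. arctan y - ?l y) has_real_derivative y^8 / (1 + y\<^sup>2)) (at y)" for y
    by (rule derivative_eq_intros refl | simp)+
      (use ne[of y] in \<open>simp add: field_simps power2_eq_square[symmetric] flip: power_add power_Suc\<close>)
  from mono[OF this] show "?l x \<le> arctan x" by simp
  have "((\<lambda>y. ?u y - arctan y) has_real_derivative y^10 / (1 + y\<^sup>2)) (at y)" for y
    by (rule derivative_eq_intros refl | simp)+
      (use ne[of y] in \<open>simp add: field_simps power2_eq_square[symmetric] flip: power_add power_Suc\<close>)
  from mono[OF this] show "arctan x \<le> ?u x" by simp
  have "((\<lambda>y. arctan y - ?k y) has_real_derivative y^4 / (1 + y\<^sup>2)) (at y)" for y
    by (rule derivative_eq_intros refl | simp)+
      (use ne[of y] in \<open>simp add: field_simps power2_eq_square[symmetric] flip: power_add power_Suc\<close>)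
  from mono[OF this] show "?k x \<le> arctan x" by simp
  show "arctan x \<le> x" using arctan_le_self[OF assms] by simp
qed

lemma pi_bounds: "3.14159 < pi" "pi < (3.141594::real)"
proof -
  have "pi = 16 * arctan (1 / 5) - 4 * arctan (1 / 239)" using machin by simp
  moreover note arctan_bounds[of "1/5"] arctan_bounds[of "1/239"]
  ultimately show "3.14159 < pi" "pi < (3.141594::real)" by (simp_all add: eval_nat_numeral)
qed

text \<open>
  The determinant in the area formula is the product of the legs by Lagrange's identity.
\<close>

lemma measure_right_triangle:
  fixes A B C :: "real^2"
  assumes "(A - C) \<bullet> (B - C) = 0"
  shows "measure lebesgue (convex hull {A, B, C}) = norm (A - C) * norm (B - C) / 2"
proof -
  have i: "x \<bullet> y = x$1 * y$1 + x$2 * y$2" for x y :: "real^2" by (simp add: inner_vec_def sum_2)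
  define D where "D = (C$1 - A$1) * (B$2 - A$2) - (B$1 - A$1) * (C$2 - A$2)"
  have "D\<^sup>2 = ((A - C) \<bullet> (A - C)) * ((B - C) \<bullet> (B - C)) - ((A - C) \<bullet> (B - C))\<^sup>2"
    unfolding i D_def by (simp add: power2_eq_square algebra_simps)
  also have "\<dots> = (norm (A - C) * norm (B - C))\<^sup>2"
    using assms by (simp add: power_mult_distrib power2_norm_eq_inner)
  finally have "sqrt (D\<^sup>2) = sqrt ((norm (A - C) * norm (B - C))\<^sup>2)" by (rule arg_cong)
  then have "\<bar>D\<bar> = norm (A - C) * norm (B - C)"
    by (simp only: real_sqrt_abs abs_mult abs_norm_cancel)
  moreover have "measure lebesgue (convex hull {A, B, C}) = measure lborel (convex hull {A, B, C})"
    by (intro measure_completion) (simp add: borel_closed compact_imp_closed compact_convex_hull)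
  ultimately show ?thesis by (simp add: content_triangle D_def)
qed

definition unit_vec :: "real \<Rightarrow> real^2" where "unit_vec \<theta> = vector [cos \<theta>, sin \<theta>]"

definition closed_sector :: "real \<Rightarrow> (real^2) set" where
  "closed_sector \<phi> = (\<lambda>(\<rho>, \<theta>). \<rho> *\<^sub>R unit_vec \<theta>) ` ({0..1} \<times> {\<phi>..\<phi> + pi / 6})"

text \<open>
  Without the centre and the final ray, twelve of these sectors partition the punctured unit disc.
\<close>

definition half_open_sector :: "real \<Rightarrow> (real^2) set" where
  "half_open_sector \<phi> = (\<lambda>(\<rho>, \<theta>). \<rho> *\<^sub>R unit_vec \<theta>) ` ({0<..1} \<times> {\<phi>..<\<phi> + pi / 6})"

lemma norm_unit_vec [simp]: "norm (unit_vec \<theta>) = 1"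
  by (simp add: norm_eq_1 unit_vec_def inner_vec_def sum_2)

lemma closed_sector_lmeasurable: "closed_sector \<phi> \<in> lmeasurable"
proof -
  have "continuous_on UNIV unit_vec"
  proof -
    have "unit_vec = (\<lambda>\<theta>. cos \<theta> *\<^sub>R axis 1 1 + sin \<theta> *\<^sub>R axis 2 1)"
      by (auto simp: unit_vec_def vec_eq_iff forall_2 axis_def)
    show "continuous_on UNIV unit_vec" unfolding \<open>unit_vec = _\<close> by (intro continuous_intros)
  qed
  then have "compact (closed_sector \<phi>)"
    unfolding closed_sector_def case_prod_unfold
    by (intro compact_continuous_image compact_Times) (auto intro!: continuous_intros continuous_on_compose2[of UNIV unit_vec])
  then show ?thesis by (rule lmeasurable_compact)
qed

text \<open>
  Rotations preserve the measure.
\<close>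

lemma measure_closed_sector: "measure lebesgue (closed_sector \<phi>) = measure lebesgue (closed_sector 0)"
proof -
  define f where "f x = (vector [cos \<phi> * x$1 - sin \<phi> * x$2, sin \<phi> * x$1 + cos \<phi> * x$2] :: real^2)" for x :: "real^2"
  have "linear f"
    by (rule linearI) (simp_all add: f_def vec_eq_iff forall_2 algebra_simps)
  moreover have "norm (f x) = norm x" for x
  proof -
    have "(cos \<phi> * a - sin \<phi> * b)\<^sup>2 + (sin \<phi> * a + cos \<phi> * b)\<^sup>2 = ((sin \<phi>)\<^sup>2 + (cos \<phi>)\<^sup>2) * (a\<^sup>2 + b\<^sup>2)" for a b
      by algebra
    then show ?thesis
      by (simp add: norm_eq_sqrt_inner inner_vec_def sum_2 f_def power2_eq_square[symmetric])
  qed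
  ultimately have "orthogonal_transformation f" by (simp add: orthogonal_transformation)
  moreover have "f ` closed_sector 0 = closed_sector \<phi>"
  proof -
    have "f (\<rho> *\<^sub>R unit_vec \<theta>) = \<rho> *\<^sub>R unit_vec (\<phi> + \<theta>)" for \<rho> \<theta>
      by (simp add: f_def unit_vec_def vec_eq_iff forall_2 cos_add sin_add algebra_simps)
    then have "f ` closed_sector 0 = (\<lambda>(\<rho>, \<theta>). \<rho> *\<^sub>R unit_vec \<theta>) ` ((\<lambda>(\<rho>, \<theta>). (\<rho>, \<phi> + \<theta>)) ` ({0..1} \<times> {0..pi / 6}))"
      unfolding closed_sector_def image_image by (intro image_cong) auto
    also have "(\<lambda>(\<rho>, \<theta>). (\<rho>, \<phi> + \<theta>)) ` ({0..1} \<times> {0..pi / 6}) = (\<lambda>\<rho>. \<rho>) ` {0..1::real} \<times> (+) \<phi> ` {0..pi / 6}"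
      by (rule image_paired_Times)
    finally show ?thesis by (simp add: closed_sector_def add.commute)
  qed
  ultimately show ?thesis using measure_orthogonal_image[OF _ closed_sector_lmeasurable] by metis
qed

text \<open>
  The missing points lie on the line through the origin at angle \<open>\<phi> + pi / 6\<close>.
\<close>

lemma closed_sector_boundary_null: "closed_sector \<phi> - half_open_sector \<phi> \<in> null_sets lebesgue"
proof -
  define \<beta> where "\<beta> = \<phi> + pi / 6"
  define n :: "real^2" where "n = vector [- sin \<beta>, cos \<beta>]"
  have "n \<bullet> n = 1" by (simp add: n_def inner_vec_def sum_2 flip: power2_eq_square)
  then have "n \<noteq> 0" by auto
  have "closed_sector \<phi> - half_open_sector \<phi> \<subseteq> {x. n \<bullet> x = 0}"
  proof
    fix x assume x: "x \<in> closed_sector \<phi> - half_open_sector \<phi>"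
    then obtain \<rho> \<theta> where r: "x = \<rho> *\<^sub>R unit_vec \<theta>" "0 \<le> \<rho>" "\<rho> \<le> 1" "\<phi> \<le> \<theta>" "\<theta> \<le> \<phi> + pi / 6"
      by (auto simp: closed_sector_def)
    have "\<rho> = 0 \<or> \<theta> = \<phi> + pi / 6"
    proof (rule ccontr)
      assume "\<not> ?thesis"
      with r have "x \<in> half_open_sector \<phi>" unfolding half_open_sector_def by (intro image_eqI[of _ _ "(\<rho>, \<theta>)"]) auto
      with x show False by simp
    qed
    moreover have "n \<bullet> unit_vec (\<phi> + pi / 6) = 0"
      unfolding \<beta>_def[symmetric] by (simp add: n_def unit_vec_def inner_vec_def sum_2)
    ultimately show "x \<in> {x. n \<bullet> x = 0}" using r by auto
  qed
  then show ?thesis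
    using negligible_hyperplane[of n 0] \<open>n \<noteq> 0\<close> negligible_subset negligible_iff_null_sets by blast
qed

lemma half_open_sector_measure: "half_open_sector \<phi> \<in> lmeasurable" "measure lebesgue (half_open_sector \<phi>) = measure lebesgue (closed_sector 0)"
proof -
  have "half_open_sector \<phi> \<subseteq> closed_sector \<phi>" unfolding half_open_sector_def closed_sector_def by (intro image_mono) auto
  then have c: "half_open_sector \<phi> = closed_sector \<phi> - (closed_sector \<phi> - half_open_sector \<phi>)" by blast
  show "half_open_sector \<phi> \<in> lmeasurable"
    by (subst c) (intro fmeasurable_Diff closed_sector_lmeasurable null_setsD2 closed_sector_boundary_null)
  show "measure lebesgue (half_open_sector \<phi>) = measure lebesgue (closed_sector 0)"
    by (subst c) (simp add: measure_Diff_null_set closed_sector_boundary_null fmeasurableD closed_sector_lmeasurable measure_closed_sector[of \<phi>])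
qed

lemma unit_vec_inj:
  assumes "unit_vec \<theta> = unit_vec \<theta>'" "0 \<le> \<theta>" "\<theta> < 2 * pi" "0 \<le> \<theta>'" "\<theta>' < 2 * pi"
  shows "\<theta> = \<theta>'"
proof -
  have "cos \<theta> = cos \<theta>'" "sin \<theta> = sin \<theta>'"
    using assms(1) by (simp_all add: unit_vec_def vec_eq_iff forall_2)
  then obtain n :: int where n: "\<theta> = \<theta>' + 2 * pi * n" using sin_cos_eq_iff by blast
  have "2 * pi * n < 2 * pi * 1" "2 * pi * (- 1) < 2 * pi * n" using n assms by linarith+
  then have "real_of_int n < 1" "- 1 < real_of_int n"
    using pi_gt_zero by (simp_all only: mult_less_cancel_left_pos[of "2 * pi"] mult_pos_pos zero_less_numeral)
  then have "n = 0" by linarith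
  with n show ?thesis by simp
qed

lemma polar_decomposition: "\<exists>\<theta>. 0 \<le> \<theta> \<and> \<theta> < 2 * pi \<and> x = norm x *\<^sub>R unit_vec \<theta>"
proof (cases "x = 0")
  case True
  then show ?thesis by (intro exI[of _ 0]) simp
next
  case False
  have "(x$1 / norm x)\<^sup>2 + (x$2 / norm x)\<^sup>2 = (x \<bullet> x) / (norm x)\<^sup>2"
    by (simp add: power_divide inner_vec_def sum_2 power2_eq_square add_divide_distrib)
  also have "\<dots> = 1" using False by (simp add: power2_norm_eq_inner)
  finally obtain \<theta> where \<theta>: "0 \<le> \<theta>" "\<theta> < 2 * pi" and cs: "x$1 / norm x = cos \<theta>" "x$2 / norm x = sin \<theta>"
    by (rule sincos_total_2pi)
  have "(norm x *\<^sub>R unit_vec \<theta>)$1 = x$1" "(norm x *\<^sub>R unit_vec \<theta>)$2 = x$2"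
    using False by (simp_all add: unit_vec_def flip: cs)
  then have "x = norm x *\<^sub>R unit_vec \<theta>" by (simp only: vec_eq_iff forall_2)
  with \<theta> show ?thesis by blast
qed

lemma half_open_sectors_partition_disc: "(\<Union>k<12. half_open_sector (real k * (pi / 6))) = cball 0 1 - {0}"
proof (intro equalityI subsetI)
  fix x assume "x \<in> (\<Union>k<12. half_open_sector (real k * (pi / 6)))"
  then obtain \<rho> \<theta> where "x = \<rho> *\<^sub>R unit_vec \<theta>" "0 < \<rho>" "\<rho> \<le> 1" by (auto simp: half_open_sector_def)
  moreover have "unit_vec \<theta> \<noteq> 0" using norm_unit_vec[of \<theta>] by (metis norm_zero zero_neq_one)
  ultimately show "x \<in> cball 0 1 - {0}" by simp
next
  fix x :: "real^2" assume x: "x \<in> cball 0 1 - {0}"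
  obtain \<theta> where \<theta>: "0 \<le> \<theta>" "\<theta> < 2 * pi" "x = norm x *\<^sub>R unit_vec \<theta>"
    using polar_decomposition by blast
  define k where "k = nat \<lfloor>\<theta> / (pi / 6)\<rfloor>"
  have k: "real k \<le> \<theta> / (pi / 6)" "\<theta> / (pi / 6) < real k + 1"
    using \<theta>(1) by (simp_all add: k_def)
  have "\<theta> / (pi / 6) < 12" using \<theta>(2) by (simp add: pos_divide_less_eq)
  with k(1) have "k < 12" by simp
  moreover have "real k * (pi / 6) \<le> \<theta>" using mult_right_mono[OF k(1), of "pi / 6"] by simp
  moreover have "\<theta> < real k * (pi / 6) + pi / 6"
    using k(2) by (simp add: pos_divide_less_eq algebra_simps)
  ultimately show "x \<in> (\<Union>k<12. half_open_sector (real k * (pi / 6)))"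
    unfolding half_open_sector_def using x by (intro UN_I[of k] image_eqI[of _ _ "(norm x, \<theta>)"]) (use \<theta>(3) in auto)
qed

lemma half_open_sectorE:
  assumes "x \<in> half_open_sector \<phi>"
  obtains \<rho> \<theta> where "x = \<rho> *\<^sub>R unit_vec \<theta>" "0 < \<rho>" "\<phi> \<le> \<theta>" "\<theta> < \<phi> + pi / 6"
  using assms unfolding half_open_sector_def by (elim imageE SigmaE) (simp add: that)

lemma half_open_sectors_disjoint: "disjoint_family_on (\<lambda>k. half_open_sector (real k * (pi / 6))) {..<12}"
  unfolding disjoint_family_on_def
proof (intro ballI impI equals0I)
  fix i j :: nat and x
  assume ij: "i \<in> {..<12}" "j \<in> {..<12}" "i \<noteq> j"
    and x: "x \<in> half_open_sector (real i * (pi / 6)) \<inter> half_open_sector (real j * (pi / 6))"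
  from x obtain \<rho> \<theta> where r1: "x = \<rho> *\<^sub>R unit_vec \<theta>" "0 < \<rho>"
    and t1: "real i * (pi / 6) \<le> \<theta>" "\<theta> < real i * (pi / 6) + pi / 6"
    by (blast elim: half_open_sectorE)
  from x obtain \<rho>' \<theta>' where r2: "x = \<rho>' *\<^sub>R unit_vec \<theta>'" "0 < \<rho>'"
    and t2: "real j * (pi / 6) \<le> \<theta>'" "\<theta>' < real j * (pi / 6) + pi / 6"
    by (blast elim: half_open_sectorE)
  note t = t1 t2
  have "norm x = \<rho>" unfolding r1(1) using r1(2) by simp
  moreover have "norm x = \<rho>'" unfolding r2(1) using r2(2) by simp
  ultimately have "\<rho> = \<rho>'" by simp
  with r1 r2 have "unit_vec \<theta> = unit_vec \<theta>'" by simp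
  moreover have "0 \<le> real i * (pi / 6)" "0 \<le> real j * (pi / 6)" by simp_all
  moreover have "real k * (pi / 6) + pi / 6 \<le> 2 * pi" if "k < 12" for k :: nat
  proof -
    have "(real k + 1) * (pi / 6) \<le> 12 * (pi / 6)" using that by (intro mult_right_mono) simp_all
    moreover have "(real k + 1) * (pi / 6) = real k * (pi / 6) + pi / 6" by (simp only: distrib_right mult_1_left)
    ultimately show ?thesis by linarith
  qed
  from this[of i] this[of j] ij
  have "real i * (pi / 6) + pi / 6 \<le> 2 * pi" "real j * (pi / 6) + pi / 6 \<le> 2 * pi" by simp_all
  ultimately have "\<theta> = \<theta>'"
    using t by (intro unit_vec_inj; linarith)
  with t have lt: "real i * (pi / 6) < (real j + 1) * (pi / 6)" "real j * (pi / 6) < (real i + 1) * (pi / 6)"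
    by (simp_all add: distrib_right)
  have "0 \<le> pi / 6" by simp
  from mult_right_less_imp_less[OF lt(1) this] mult_right_less_imp_less[OF lt(2) this]
  have "real i < real j + 1" "real j < real i + 1" .
  with ij show False by simp
qed

lemma measure_circular_sector: "measure lebesgue (circular_sector p 1 \<phi> (pi / 6)) = pi / 12"
proof -
  have "circular_sector p 1 \<phi> (pi / 6) = (+) p ` closed_sector \<phi>"
    unfolding circular_sector_def closed_sector_def unit_vec_def by force
  then have "measure lebesgue (circular_sector p 1 \<phi> (pi / 6)) = measure lebesgue (closed_sector 0)"
    by (simp add: measure_translation measure_closed_sector[of \<phi>])
  moreover have "12 * measure lebesgue (closed_sector 0) = pi"
  proof -
    have "measure lebesgue (\<Union>k<12. half_open_sector (real k * (pi / 6))) = (\<Sum>k<12. measure lebesgue (half_open_sector (real k * (pi / 6))))"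
    proof (rule measure_finite_Union[OF _ _ half_open_sectors_disjoint])
      show "emeasure lebesgue (half_open_sector (real k * (pi / 6))) \<noteq> \<infinity>" for k
        unfolding infinity_ennreal_def by (rule fmeasurableD2[OF half_open_sector_measure(1)])
    qed (use fmeasurableD[OF half_open_sector_measure(1)] in auto)
    also have "\<dots> = 12 * measure lebesgue (closed_sector 0)" by (simp add: half_open_sector_measure(2))
    finally have "12 * measure lebesgue (closed_sector 0) = measure lebesgue (cball 0 1 - {0 :: real^2})"
      unfolding half_open_sectors_partition_disc by (rule sym)
    also have "\<dots> = measure lebesgue (cball (0 :: real^2) 1)"
      by (intro measure_Diff_null_set) (simp_all add: negligible_iff_null_sets[symmetric])
    also have "\<dots> = measure lborel (cball (0 :: real^2) 1)" by (rule measure_completion) simp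
    also have "\<dots> = pi" by (simp add: content_cball unit_ball_vol_2)
    finally show ?thesis .
  qed
  ultimately show ?thesis by simp
qed

section \<open>The covering theorem\<close>

theorem proposition20:
  fixes A B C :: "real^2" and a b c :: real and T T' :: "(real^2) set"
  assumes "a = (3 + 4 * sqrt 3) / 18" and "b = (4 + sqrt 3) / 6" and "c = 2 * a"
    and "angle_at B A C = pi / 6" and "angle_at A B C = pi / 3" and "angle_at A C B = pi / 2"
    and "dist B C = a" and "dist A C = b" and "dist A B = c"
    and "T = convex hull {A, B, C}"
    and "T' = (\<lambda>x. (1 / 1.0048) *\<^sub>R x) ` T"
  shows "covers_unit_arcs T' \<and>
    measure lebesgue T' = (1 / 1.0048)\<^sup>2 * ((24 + 19 * sqrt 3) / 216) \<and>
    0.260956 \<le> measure lebesgue T' \<and> measure lebesgue T' < 0.260957 \<and>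
    measure lebesgue T' < pi / 12 \<and>
    (\<forall>p \<phi>. measure lebesgue (circular_sector p 1 \<phi> (pi / 6)) = pi / 12) \<and>
    \<bar>pi / 12 - 0.261799\<bar> \<le> 0.0000005"
proof -
  define \<sigma> :: real where "\<sigma> = 1 / 1.0048"
  have sides: "norm (B - C) = a" "norm (A - C) = b" "norm (A - B) = c"
    using assms(7-9) by (simp_all add: dist_norm)
  have ba: "b = sqrt 3 * a" unfolding assms(1,2) by (simp add: field_simps)
  have "(A - C) \<bullet> (B - C) = ((norm (A - C))\<^sup>2 + (norm (B - C))\<^sup>2 - (norm (A - B))\<^sup>2) / 2"
    using dot_norm_neg[of "A - C" "B - C"] by simp
  also have "\<dots> = 0" unfolding sides ba assms(3) by (simp add: power_mult_distrib)
  finally have perp: "(A - C) \<bullet> (B - C) = 0" .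
  have T': "T' = convex hull {\<sigma> *\<^sub>R A, \<sigma> *\<^sub>R B, \<sigma> *\<^sub>R C}"
    unfolding assms(10,11) \<sigma>_def[symmetric] convex_hull_scaling[symmetric] by simp
  have s0: "0 < \<sigma>" by (simp add: \<sigma>_def)
  have perp': "(\<sigma> *\<^sub>R A - \<sigma> *\<^sub>R C) \<bullet> (\<sigma> *\<^sub>R B - \<sigma> *\<^sub>R C) = 0"
    using perp by (simp add: scaleR_diff_right[symmetric])
  have sides': "norm (\<sigma> *\<^sub>R B - \<sigma> *\<^sub>R C) = \<sigma> * a" "norm (\<sigma> *\<^sub>R A - \<sigma> *\<^sub>R C) = \<sigma> * b"
    using s0 by (simp_all add: scaleR_diff_right[symmetric] sides)
  have "covers_unit_arcs T'"
    unfolding T'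
  proof (rule unit_arc_covered[OF perp' sides'(1) _ _ _ touching_order_tree_refutes])
    show "0 < \<sigma> * a" using s0 unfolding assms(1) by (simp add: add_pos_pos)
    have "\<sigma> * b = beta" unfolding assms(2) beta_def \<sigma>_def by simp
    with sides'(2) show "norm (\<sigma> *\<^sub>R A - \<sigma> *\<^sub>R C) = beta" by (rule trans)
    show "beta = sqrt 3 * (\<sigma> * a)"
      using ba unfolding assms(2) beta_def \<sigma>_def by simp
  qed
  moreover have area: "measure lebesgue T' = (1 / 1.0048)\<^sup>2 * ((24 + 19 * sqrt 3) / 216)"
  proof -
    have "measure lebesgue T' = \<sigma>\<^sup>2 * (a * b / 2)"
      unfolding T' measure_right_triangle[OF perp'] sides' by (simp add: power2_eq_square)
    also have "a * b / 2 = (24 + 19 * sqrt 3) / 216"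
      unfolding assms(1,2) by (simp add: field_simps)
    finally show ?thesis by (simp add: \<sigma>_def)
  qed
  moreover have "0.260956 \<le> measure lebesgue T'" "measure lebesgue T' < 0.260957"
    unfolding area using sqrt3_bounds by (simp_all add: power2_eq_square)
  moreover have "0.260957 < pi / 12" "\<bar>pi / 12 - 0.261799\<bar> \<le> 0.0000005"
    using pi_bounds by (simp_all add: abs_le_iff)
  ultimately show ?thesis using measure_circular_sector by simp
qed

end
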